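(* Let $P=(p_{ij})_{i,j\in\{1,2\}}$ be an irreducible column-stochastic $2\times 2$ matrix ($p_{ij}\ge 0$, $\sum_i p_{ij}=1$ for each $j$), and let $\pi=(\pi_1,\pi_2)$ be its unique invariant probability vector ($P\pi=\pi$). Let $V_{ij}=\sqrt{p_{ij}}\,|i\rangle\langle j|\in M_2$, let $\mu=\sum_{i,j}\delta_{V_{ij}}$, and let $L:M_2\to M_2$ be the identity map $L(v)=v$. Then the Lyapunov exponents $\gamma_1\ge\gamma_2$ of $(L,\mu)$ satisfy $$\gamma_1=\frac12\sum_{i,j}\pi_j\,p_{ij}\log p_{ij}=-\frac12 h,\qquad \gamma_2=-\infty,$$ where $h=-\sum_{i,j}\pi_j p_{ij}\log p_{ij}$ is the entropy of the stationary Markov measure associated to $P$.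
   Context: $M_2$ is the space of complex $2\times2$ matrices; $|i\rangle\langle j|$ is the matrix unit with entry $1$ in position $(i,j)$ and $0$ elsewhere. Convention: $0\log 0=0$ and $\log 0=-\infty$. Let $\rho=\mathrm{diag}(\pi_1,\pi_2)$, which is the density matrix (positive semidefinite, trace one) fixed by the channel $\phi_L(\rho)=\int_{M_2}L(v)\rho L(v)^*\,d\mu(v)$. On $\Omega=M_2^{\mathbb{N}}$, $\omega=(\omega_1,\omega_2,\dots)$, put $W_n(\omega)=L(\omega_n)\cdots L(\omega_1)$. Let $\mathbb{P}$ be the probability measure on $\Omega$ (with the product $\sigma$-algebra) determined by $\mathbb{P}(O_n)=\int_{O_n}\mathrm{tr}(W_n(\omega)\rho W_n(\omega)^* )\,d\mu^{\otimes n}(\omega)$ for every $n$ and every set $O_n$ depending only on the first $n$ coordinates. The Lyapunov exponents $\infty>\gamma_1\ge\gamma_2\ge-\infty$ are the numbers such that, $\mathbb{P}$-almost surely, $\lim_{n\to\infty}\frac1n\log\|W_n\|=\gamma_1$ and $\lim_{n\to\infty}\frac1n\log\|\bigwedge^2 W_n\|=\gamma_1+\gamma_2$. Here $\|\bigwedge^pW_n\|=a_1(W_n)\cdots a_p(W_n)$ with $a_1\ge a_2$ the singular values of $W_n$. *)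

theory Defs
  imports "HOL-Probability.Probability"
begin

subsection \<open>Matrices\<close>

definition matrix_unit :: "'n \<Rightarrow> 'n \<Rightarrow> complex^'n^'n" where
  "matrix_unit i j = (\<chi> a b. if a = i \<and> b = j then 1 else 0)"

definition conj_transpose :: "complex^'n^'m \<Rightarrow> complex^'m^'n" where
  "conj_transpose A = (\<chi> i j. cnj (A $ j $ i))"

definition positive_semidefinite :: "complex^'n^'n \<Rightarrow> bool" where
  "positive_semidefinite A \<longleftrightarrow>
     (\<forall>x. let q = (\<Sum>i\<in>UNIV. cnj (x $ i) * (A *v x) $ i) in q \<in> \<real> \<and> 0 \<le> Re q)"

definition density_matrix :: "complex^'n^'n \<Rightarrow> bool" where
  "density_matrix \<rho> \<longleftrightarrow> positive_semidefinite \<rho> \<and> trace \<rho> = 1"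

definition diag_matrix :: "real^'n \<Rightarrow> complex^'n^'n" where
  "diag_matrix d = (\<chi> i j. if i = j then complex_of_real (d $ i) else 0)"

definition operator_norm :: "complex^'n^'m \<Rightarrow> real" where
  "operator_norm A = onorm (\<lambda>x. A *v x)"

text \<open>
  The list of the singular values in decreasing order, that is, the square roots of the
  eigenvalues of \<open>A\<^sup>* A\<close> repeated according to their algebraic multiplicity (the displayed
  identity is the factorisation of the characteristic polynomial of \<open>A\<^sup>* A\<close>).
\<close>
definition singular_values :: "complex^'n^'n \<Rightarrow> real list" where
  "singular_values A = (THE as. length as = CARD('n) \<and> sorted_wrt (\<ge>) as \<and> (\<forall>a\<in>set as. 0 \<le> a) \<and>
     (\<forall>z. det (mat z - conj_transpose A ** A) = (\<Prod>a\<leftarrow>as. z - complex_of_real (a\<^sup>2))))"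

definition ext_power_norm :: "nat \<Rightarrow> complex^'n^'n \<Rightarrow> real" where
  "ext_power_norm p A = prod_list (take p (singular_values A))"

subsection \<open>Products of random matrices\<close>

text \<open>
  \<open>\<omega>\<close> is indexed from \<open>0\<close>, so that \<open>\<omega> k\<close> is the coordinate \<open>\<omega>\<^sub>k\<^sub>+\<^sub>1\<close> of the usual notation.
\<close>
primrec matrix_product ::
    "(complex^'n^'n \<Rightarrow> complex^'n^'n) \<Rightarrow> nat \<Rightarrow> (nat \<Rightarrow> complex^'n^'n) \<Rightarrow> complex^'n^'n" where
  "matrix_product L 0 \<omega> = mat 1"
| "matrix_product L (Suc n) \<omega> = L (\<omega> n) ** matrix_product L n \<omega>"

definition channel ::
    "(complex^'n^'n \<Rightarrow> complex^'n^'n) \<Rightarrow> (complex^'n^'n) measure \<Rightarrow> complex^'n^'n \<Rightarrow> complex^'n^'n" where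
  "channel L \<mu> \<rho> = (\<integral>v. L v ** \<rho> ** conj_transpose (L v) \<partial>\<mu>)"

text \<open>
  The sets depending only on the first \<open>n\<close> coordinates are the cylinders
  \<open>prod_emb UNIV (\<lambda>_. borel) {..<n} A\<close> over measurable sets \<open>A\<close> of \<open>n\<close>-tuples of matrices, and
  \<open>PiM {..<n} (\<lambda>_. \<mu>)\<close> is the \<open>n\<close>-fold product of \<open>\<mu>\<close>.  For positive semidefinite \<open>\<rho>\<close> the
  trace is real and nonnegative, so nothing is lost by taking \<open>ennreal (Re _)\<close>.
\<close>
definition is_path_measure ::
    "(complex^'n^'n \<Rightarrow> complex^'n^'n) \<Rightarrow> (complex^'n^'n) measure \<Rightarrow> complex^'n^'n \<Rightarrow>
     (nat \<Rightarrow> complex^'n^'n) measure \<Rightarrow> bool" where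
  "is_path_measure L \<mu> \<rho> \<P> \<longleftrightarrow>
     prob_space \<P> \<and> sets \<P> = sets (PiM UNIV (\<lambda>_. borel)) \<and>
     (\<forall>n. \<forall>A \<in> sets (PiM {..<n} (\<lambda>_. borel)).
        emeasure \<P> (prod_emb UNIV (\<lambda>_. borel) {..<n} A) =
        (\<integral>\<^sup>+\<omega>\<in>A. ennreal (Re (trace (matrix_product L n \<omega> ** \<rho> ** conj_transpose (matrix_product L n \<omega>))))
           \<partial>PiM {..<n} (\<lambda>_. \<mu>)))"

definition path_measure ::
    "(complex^'n^'n \<Rightarrow> complex^'n^'n) \<Rightarrow> (complex^'n^'n) measure \<Rightarrow> complex^'n^'n \<Rightarrow>
     (nat \<Rightarrow> complex^'n^'n) measure" where
  "path_measure L \<mu> \<rho> = (THE \<P>. is_path_measure L \<mu> \<rho> \<P>)"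

definition ereal_log :: "real \<Rightarrow> ereal" where
  "ereal_log x = (if x = 0 then -\<infinity> else ereal (ln x))"

definition lyapunov_exponents ::
    "(complex^2^2 \<Rightarrow> complex^2^2) \<Rightarrow> (complex^2^2) measure \<Rightarrow> complex^2^2 \<Rightarrow> ereal \<Rightarrow> ereal \<Rightarrow> bool" where
  "lyapunov_exponents L \<mu> \<rho> \<gamma>\<^sub>1 \<gamma>\<^sub>2 \<longleftrightarrow>
     \<gamma>\<^sub>1 < \<infinity> \<and> \<gamma>\<^sub>2 \<le> \<gamma>\<^sub>1 \<and>
     (AE \<omega> in path_measure L \<mu> \<rho>.
        (\<lambda>n. ereal (1 / real n) * ereal_log (operator_norm (matrix_product L n \<omega>))) \<longlonglongrightarrow> \<gamma>\<^sub>1) \<and>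
     (AE \<omega> in path_measure L \<mu> \<rho>.
        (\<lambda>n. ereal (1 / real n) * ereal_log (ext_power_norm 2 (matrix_product L n \<omega>))) \<longlonglongrightarrow> \<gamma>\<^sub>1 + \<gamma>\<^sub>2)"

subsection \<open>Markov chains\<close>

definition column_stochastic :: "real^'n^'n \<Rightarrow> bool" where
  "column_stochastic P \<longleftrightarrow> (\<forall>i j. 0 \<le> P $ i $ j) \<and> (\<forall>j. (\<Sum>i\<in>UNIV. P $ i $ j) = 1)"

definition irreducible_matrix :: "real^'n^'n \<Rightarrow> bool" where
  "irreducible_matrix P \<longleftrightarrow> (\<forall>i j. \<exists>n. 0 < (((**) P ^^ n) (mat 1)) $ i $ j)"

definition invariant_probability :: "real^'n^'n \<Rightarrow> real^'n \<Rightarrow> bool" where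
  "invariant_probability P p \<longleftrightarrow> (\<forall>i. 0 \<le> p $ i) \<and> (\<Sum>i\<in>UNIV. p $ i) = 1 \<and> P *v p = p"

text \<open>
  The convention \<open>0 log 0 = 0\<close> is automatic here, because \<open>ln 0\<close> is a real number in HOL.
\<close>
definition markov_entropy :: "real^'n^'n \<Rightarrow> real^'n \<Rightarrow> real" where
  "markov_entropy P p = - (\<Sum>i\<in>UNIV. \<Sum>j\<in>UNIV. p $ j * P $ i $ j * ln (P $ i $ j))"

definition markov_kraus :: "real^'n^'n \<Rightarrow> 'n \<Rightarrow> 'n \<Rightarrow> complex^'n^'n" where
  "markov_kraus P i j = sqrt (P $ i $ j) *\<^sub>R matrix_unit i j"

definition markov_kraus_measure :: "real^'n^'n \<Rightarrow> (complex^'n^'n) measure" where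
  "markov_kraus_measure P = measure_of UNIV (sets borel)
     (\<lambda>A. \<Sum>i\<in>UNIV. \<Sum>j\<in>UNIV. emeasure (return borel (markov_kraus P i j)) A)"

lemma sets_markov_kraus_measure [simp, measurable_cong]:
  "sets (markov_kraus_measure P) = sets borel"
  unfolding markov_kraus_measure_def using sets.sets_measure_of_eq[of borel] by simp

lemma markov_kraus_measure_eq_distr:
  "markov_kraus_measure P = distr (count_space UNIV) borel (\<lambda>(i, j). markov_kraus P i j)"
proof -
  have *: "(\<Sum>i\<in>UNIV. \<Sum>j\<in>UNIV. emeasure (return borel (markov_kraus P i j)) A) =
      emeasure (distr (count_space UNIV) borel (\<lambda>(i, j). markov_kraus P i j)) A"
    if "A \<in> sets borel" for A
  proof -
    have "emeasure (distr (count_space UNIV) borel (\<lambda>(i, j). markov_kraus P i j)) A =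
        emeasure (count_space UNIV) ((\<lambda>(i, j). markov_kraus P i j) -` A)"
      using that by (subst emeasure_distr) auto
    also have "\<dots> = (\<integral>\<^sup>+x. indicator ((\<lambda>(i, j). markov_kraus P i j) -` A) x \<partial>count_space UNIV)"
      by simp
    also have "\<dots> = (\<Sum>x\<in>UNIV. indicator ((\<lambda>(i, j). markov_kraus P i j) -` A) x)"
      by (rule nn_integral_count_space_finite) simp
    also have "\<dots> = (\<Sum>(i, j)\<in>UNIV \<times> UNIV. indicator A (markov_kraus P i j))"
      unfolding UNIV_Times_UNIV by (intro sum.cong) (auto simp: indicator_def)
    also have "\<dots> = (\<Sum>i\<in>UNIV. \<Sum>j\<in>UNIV. indicator A (markov_kraus P i j))"
      by (subst sum.cartesian_product) simp
    finally show ?thesis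
      using that by (simp add: emeasure_return)
  qed
  have "markov_kraus_measure P = measure_of (space borel) (sets borel)
      (emeasure (distr (count_space UNIV) borel (\<lambda>(i, j). markov_kraus P i j)))"
    unfolding markov_kraus_measure_def space_borel
    by (rule measure_of_eq) (simp_all only: * sets.sigma_sets_eq[of borel, simplified] subset_UNIV Pow_UNIV)
  also have "\<dots> = distr (count_space UNIV) borel (\<lambda>(i, j). markov_kraus P i j)"
    using measure_of_of_measure[of "distr (count_space UNIV) borel (\<lambda>(i, j). markov_kraus P i j)"]
    by simp
  finally show ?thesis .
qed

lemma channel_markov_kraus:
  fixes P :: "real^'n^'n"
  shows "channel (\<lambda>v. v) (markov_kraus_measure P) \<rho> =
     (\<Sum>i\<in>UNIV. \<Sum>j\<in>UNIV. markov_kraus P i j ** \<rho> ** conj_transpose (markov_kraus P i j))"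
proof -
  have "continuous_on UNIV (\<lambda>v::complex^'n^'n. v ** \<rho> ** conj_transpose v)"
    unfolding matrix_matrix_mult_def conj_transpose_def by (intro continuous_intros) 
  then have "(\<lambda>v::complex^'n^'n. v ** \<rho> ** conj_transpose v) \<in> borel_measurable borel"
    by (rule borel_measurable_continuous_onI)
  then show ?thesis
    unfolding channel_def markov_kraus_measure_eq_distr
    by (subst integral_distr)
       (auto simp: lebesgue_integral_count_space_finite case_prod_unfold sum.cartesian_product
             simp flip: UNIV_Times_UNIV)
qed

lemma markov_kraus_conjugation:
  assumes "0 \<le> P $ i $ j"
  shows "markov_kraus P i j ** \<rho> ** conj_transpose (markov_kraus P i j) =
    (\<chi> a b. if a = i \<and> b = i then complex_of_real (P $ i $ j) * \<rho> $ j $ j else 0)"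
proof -
  define c where "c = complex_of_real (sqrt (P $ i $ j))"
  have cc: "c * cnj c = complex_of_real (P $ i $ j)"
    using assms by (simp add: c_def flip: of_real_mult)
  have K: "markov_kraus P i j $ a $ b = (if b = j then if a = i then c else 0 else 0)" for a b
    by (simp add: markov_kraus_def matrix_unit_def c_def) (simp add: scaleR_conv_of_real)
  have 1: "(markov_kraus P i j ** \<rho>) $ a $ b = (if a = i then c * \<rho> $ j $ b else 0)" for a b
  proof -
    have "(markov_kraus P i j ** \<rho>) $ a $ b =
        (\<Sum>k\<in>UNIV. if k = j then if a = i then c * \<rho> $ j $ b else 0 else 0)"
      unfolding matrix_matrix_mult_def vec_lambda_beta by (intro sum.cong) (auto simp: K)
    then show ?thesis by simp
  qed
  have "(markov_kraus P i j ** \<rho> ** conj_transpose (markov_kraus P i j)) $ a $ b =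
      (if a = i \<and> b = i then complex_of_real (P $ i $ j) * \<rho> $ j $ j else 0)" for a b
  proof -
    have "(markov_kraus P i j ** \<rho> ** conj_transpose (markov_kraus P i j)) $ a $ b =
        (\<Sum>k\<in>UNIV. (markov_kraus P i j ** \<rho>) $ a $ k * cnj (markov_kraus P i j $ b $ k))"
      by (simp add: matrix_matrix_mult_def[of "markov_kraus P i j ** \<rho>"] conj_transpose_def)
    also have "\<dots> = (\<Sum>k\<in>UNIV. if k = j then
        if a = i \<and> b = i then c * cnj c * \<rho> $ j $ j else 0 else 0)"
      by (intro sum.cong) (auto simp: K 1)
    finally show ?thesis by (simp add: cc)
  qed
  then show ?thesis by (simp add: vec_eq_iff)
qed

lemma channel_markov_kraus_diag:
  fixes P :: "real^'n^'n"
  assumes "column_stochastic P"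
  shows "channel (\<lambda>v. v) (markov_kraus_measure P) \<rho> =
    (\<chi> a b. if a = b then \<Sum>j\<in>UNIV. complex_of_real (P $ a $ j) * \<rho> $ j $ j else 0)"
proof -
  have "0 \<le> P $ i $ j" for i j
    using assms by (auto simp: column_stochastic_def)
  then have "channel (\<lambda>v. v) (markov_kraus_measure P) \<rho> = (\<Sum>i\<in>UNIV. \<Sum>j\<in>UNIV.
      (\<chi> a b. if a = i \<and> b = i then complex_of_real (P $ i $ j) * \<rho> $ j $ j else 0))"
    by (simp add: channel_markov_kraus markov_kraus_conjugation)
  also have "\<dots> = (\<chi> a b. if a = b then \<Sum>j\<in>UNIV. complex_of_real (P $ a $ j) * \<rho> $ j $ j else 0)"
  proof -
    have "(\<Sum>i\<in>UNIV. \<Sum>j\<in>UNIV. if a = i \<and> b = i then f i j else 0) =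
        (if a = b then \<Sum>j\<in>UNIV. f a j else 0)" for a b :: 'n and f :: "'n \<Rightarrow> 'n \<Rightarrow> complex"
    proof -
      have "(\<Sum>i\<in>UNIV. \<Sum>j\<in>UNIV. if a = i \<and> b = i then f i j else 0) =
          (\<Sum>i\<in>UNIV. if i = a then (if a = b then \<Sum>j\<in>UNIV. f a j else 0) else 0)"
        by (intro sum.cong) auto
      also have "\<dots> = (if a = b then \<Sum>j\<in>UNIV. f a j else 0)"
        by (subst sum.delta) simp_all
      finally show ?thesis .
    qed
    then show ?thesis by (simp add: vec_eq_iff)
  qed
  finally show ?thesis .
qed

lemma density_matrix_diag_matrix:
  assumes "\<forall>i. 0 \<le> p $ i" and "(\<Sum>i\<in>UNIV. p $ i) = 1"
  shows "density_matrix (diag_matrix p)"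
proof -
  have mv: "(diag_matrix p *v x) $ i = complex_of_real (p $ i) * x $ i" for x i
  proof -
    have "(diag_matrix p *v x) $ i = (\<Sum>j\<in>UNIV. if j = i then complex_of_real (p $ i) * x $ i else 0)"
      unfolding matrix_vector_mult_def diag_matrix_def vec_lambda_beta by (intro sum.cong) auto
    then show ?thesis by simp
  qed
  have "cnj (x $ i) * (diag_matrix p *v x) $ i = complex_of_real (p $ i * (cmod (x $ i))\<^sup>2)" for x i
    unfolding mv by (simp only: of_real_mult complex_norm_square) (simp add: mult_ac)
  then have "(\<Sum>i\<in>UNIV. cnj (x $ i) * (diag_matrix p *v x) $ i) =
      complex_of_real (\<Sum>i\<in>UNIV. p $ i * (cmod (x $ i))\<^sup>2)" for x
    by simp
  then have "positive_semidefinite (diag_matrix p)"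
    using assms(1) unfolding positive_semidefinite_def Let_def
    by (simp only: Re_complex_of_real Reals_of_real) (auto intro!: sum_nonneg)
  moreover have "trace (diag_matrix p) = complex_of_real (\<Sum>i\<in>UNIV. p $ i)"
    by (simp add: trace_def diag_matrix_def)
  ultimately show ?thesis
    using assms(2) by (simp add: density_matrix_def)
qed

lemma invariant_probability_unique_2:
  fixes P :: "real^2^2"
  assumes P: "column_stochastic P" "irreducible_matrix P"
    and p: "(\<Sum>i\<in>UNIV. p $ i) = 1" "P *v p = p"
    and q: "(\<Sum>i\<in>UNIV. q $ i) = 1" "P *v q = q"
  shows "p = q"
proof -
  have nonneg: "0 \<le> P $ 1 $ 2" "0 \<le> P $ 2 $ 1"
    and cols: "P $ 1 $ 1 = 1 - P $ 2 $ 1" "P $ 2 $ 2 = 1 - P $ 1 $ 2"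
    using P(1) by (auto simp: column_stochastic_def UNIV_2 forall_2)
  have "P $ 1 $ 2 \<noteq> 0"
  proof
    assume 0: "P $ 1 $ 2 = 0"
    have "(((**) P ^^ n) (mat 1)) $ 1 $ 2 = 0" for n
      by (induction n) (auto simp: mat_def matrix_matrix_mult_def UNIV_2 0)
    moreover obtain n where "0 < (((**) P ^^ n) (mat 1)) $ 1 $ 2"
      using P(2) by (auto simp: irreducible_matrix_def)
    ultimately show False by simp
  qed
  then have pos: "0 < P $ 1 $ 2 + P $ 2 $ 1" using nonneg by simp
  have *: "(P $ 1 $ 2 + P $ 2 $ 1) * r $ 1 = P $ 1 $ 2 \<and> r $ 2 = 1 - r $ 1"
    if r: "(\<Sum>i\<in>UNIV. r $ i) = 1" "P *v r = r" for r :: "real^2"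
  proof -
    have 2: "r $ 2 = 1 - r $ 1" using r(1) by (simp add: UNIV_2)
    have "P $ 1 $ 1 * r $ 1 + P $ 1 $ 2 * r $ 2 = r $ 1"
      using arg_cong[OF r(2), of "\<lambda>v. v $ 1"] by (simp add: matrix_vector_mult_def UNIV_2)
    then show ?thesis by (simp add: 2 cols algebra_simps)
  qed
  from *[OF p] *[OF q] pos show ?thesis
    by (auto simp: vec_eq_iff forall_2) (metis less_irrefl mult_left_cancel)+
qed

text \<open>
  The state \<open>diag_matrix p\<close> is the density matrix fixed by the channel of the Markov chain.
\<close>
theorem fixed_density_matrix_iff:
  fixes P :: "real^2^2"
  assumes P: "column_stochastic P" "irreducible_matrix P" and p: "invariant_probability P p"
  shows "density_matrix \<rho> \<and> channel (\<lambda>v. v) (markov_kraus_measure P) \<rho> = \<rho> \<longleftrightarrow> \<rho> = diag_matrix p"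
proof
  assume "\<rho> = diag_matrix p"
  moreover have "(\<Sum>j\<in>UNIV. complex_of_real (P $ a $ j) * complex_of_real (p $ j)) =
      complex_of_real (p $ a)" for a
  proof -
    have "(P *v p) $ a = p $ a" using p by (simp add: invariant_probability_def)
    then show ?thesis
      unfolding matrix_vector_mult_def by (simp flip: of_real_mult of_real_sum)
  qed
  ultimately show "density_matrix \<rho> \<and> channel (\<lambda>v. v) (markov_kraus_measure P) \<rho> = \<rho>"
    using p P(1) density_matrix_diag_matrix[of p]
    by (simp add: invariant_probability_def channel_markov_kraus_diag)
       (simp add: diag_matrix_def vec_eq_iff)
next
  assume \<rho>: "density_matrix \<rho> \<and> channel (\<lambda>v. v) (markov_kraus_measure P) \<rho> = \<rho>"
  define q :: "real^2" where "q = (\<chi> i. Re (\<rho> $ i $ i))"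
  have entry: "\<rho> $ a $ b = (if a = b then \<Sum>j\<in>UNIV. complex_of_real (P $ a $ j) * \<rho> $ j $ j else 0)"
    for a b
  proof -
    have "\<rho> $ a $ b = channel (\<lambda>v. v) (markov_kraus_measure P) \<rho> $ a $ b"
      using \<rho> by simp
    then show ?thesis
      unfolding channel_markov_kraus_diag[OF P(1)] by simp
  qed
  have real: "\<rho> $ a $ a \<in> \<real>" for a
  proof -
    have col: "(\<rho> *v axis a 1) $ i = \<rho> $ i $ a" for i
    proof -
      have "(\<rho> *v axis a 1) $ i = (\<Sum>k\<in>UNIV. if k = a then \<rho> $ i $ a else 0)"
        unfolding matrix_vector_mult_def vec_lambda_beta by (intro sum.cong) (auto simp: axis_def)
      then show ?thesis by simp
    qed
    have "(\<Sum>i\<in>UNIV. cnj (axis a 1 $ i) * (\<rho> *v axis a 1) $ i) = \<rho> $ a $ a"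
    proof -
      have "(\<Sum>i\<in>UNIV. cnj (axis a 1 $ i) * (\<rho> *v axis a 1) $ i) =
          (\<Sum>i\<in>UNIV. if i = a then \<rho> $ a $ a else 0)"
        unfolding col by (intro sum.cong) (auto simp: axis_def)
      then show ?thesis by simp
    qed
    moreover have "(\<Sum>i\<in>UNIV. cnj (axis a 1 $ i) * (\<rho> *v axis a 1) $ i) \<in> \<real>"
      using \<rho> unfolding density_matrix_def positive_semidefinite_def Let_def by blast
    ultimately show ?thesis by simp
  qed
  then have \<rho>q: "\<rho> $ a $ a = complex_of_real (q $ a)" for a
    by (simp add: q_def)
  have "(\<Sum>j\<in>UNIV. P $ a $ j * q $ j) = q $ a" for a
    using entry[of a a, symmetric] unfolding \<rho>q by (simp flip: of_real_mult of_real_sum)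
  then have "P *v q = q"
    by (simp add: vec_eq_iff matrix_vector_mult_def)
  moreover have "(\<Sum>i\<in>UNIV. q $ i) = 1"
    using \<rho> unfolding density_matrix_def trace_def \<rho>q by (simp flip: of_real_sum)
  ultimately have "q = p"
    using invariant_probability_unique_2[OF P] p by (simp add: invariant_probability_def)
  then show "\<rho> = diag_matrix p"
  proof -
    have "\<rho> $ a $ b = diag_matrix p $ a $ b" for a b
    proof (cases "a = b")
      case True
      then show ?thesis using \<rho>q[of a] \<open>q = p\<close> by (simp add: diag_matrix_def)
    next
      case False
      then show ?thesis using entry[of a b] by (simp add: diag_matrix_def)
    qed
    then show ?thesis by (simp add: vec_eq_iff)
  qed
qed

end

theory Submission
  imports Defs
begin

text \<open>
  Under the path measure the matrices are the Kraus operators \<open>V\<^sub>i\<^sub>j\<close> of the successive transitions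
  \<open>j \<rightarrow> i\<close> of a stationary Markov chain: the density \<open>tr(W\<^sub>n \<rho> W\<^sub>n\<^sup>*)\<close> of a cylinder is the probability of
  the trajectory, and it vanishes unless consecutive transitions fit together.  On a trajectory
  \<open>x\<^sub>0, x\<^sub>1, \<dots>\<close> the product collapses to \<open>W\<^sub>n = (\<Prod>\<^sub>k sqrt(p(x\<^sub>k\<^sub>+\<^sub>1, x\<^sub>k))) E(x\<^sub>n, x\<^sub>0)\<close>, a multiple of a matrix
  unit (\<open>matrix_product_admissible\<close>).  Its second singular value is zero, which forces
  \<open>\<gamma>\<^sub>1 + \<gamma>\<^sub>2 = -\<infinity>\<close>, and \<open>ln \<parallel>W\<^sub>n\<parallel>\<close> is half the sum of the \<open>ln p(x\<^sub>k\<^sub>+\<^sub>1, x\<^sub>k)\<close>, so that \<open>\<gamma>\<^sub>1 = - h / 2\<close> by the law of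
  large numbers for the chain.

  The law of large numbers is derived from a martingale.  The Poisson equation
  (\<open>poisson_equation_2\<close>) writes \<open>ln p\<^sub>i\<^sub>j + h\<close> as a function \<open>d\<close> of conditional mean zero plus a
  coboundary \<open>g j - g i\<close>; the coboundary telescopes, and the sums of \<open>d\<close> are \<open>o(n)\<close> almost surely by a
  fourth moment bound for bounded martingale differences
  (\<open>bounded_martingale_difference_slln\<close>, \<open>edge_observable_slln\<close>).

  Since the path measure is defined by a unique description, its existence
  (\<open>ex_prob_space_cylinder_density\<close>, applied in \<open>is_path_measure_path\<close>) and uniqueness
  (\<open>is_path_measure_unique\<close>) are part of the argument.
\<close>

section \<open>A strong law for bounded martingale differences\<close>

text \<open>
  The terms \<open>6 s\<^sup>2 d\<^sup>2\<close> and \<open>4 s d\<^sup>3\<close> of the binomial expansion are absorbed into multiples of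
  \<open>C\<^sup>2 s\<^sup>2\<close> and \<open>C\<^sup>4\<close>, so that only the term \<open>s\<^sup>3 d\<close>, which has mean zero for martingale differences, keeps
  an odd power of \<open>d\<close>.
\<close>
lemma fourth_power_increment_bound:
  fixes s d C :: real
  assumes "\<bar>d\<bar> \<le> C"
  shows "(s + d)^4 \<le> s^4 + 4 * (s^3 * d) + 8 * C\<^sup>2 * s\<^sup>2 + 3 * C^4"
proof -
  have d2: "d\<^sup>2 \<le> C\<^sup>2" using assms by (simp add: abs_le_square_iff[symmetric])
  have d4: "d^4 \<le> C^4" using power_mono[OF d2, of 2] by (simp flip: power_mult)
  have sd: "s\<^sup>2 * d\<^sup>2 \<le> C\<^sup>2 * s\<^sup>2" using mult_left_mono[OF d2, of "s\<^sup>2"] by (simp add: mult.commute)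
  have "2 * (s * d) \<le> s\<^sup>2 + d\<^sup>2" using sum_squares_bound[of s d] by simp
  then have "2 * d\<^sup>2 * (2 * (s * d)) \<le> 2 * d\<^sup>2 * (s\<^sup>2 + d\<^sup>2)" by (rule mult_left_mono) simp
  then have *: "4 * (s * d^3) \<le> 2 * (s\<^sup>2 * d\<^sup>2) + 2 * d^4"
    by (simp add: algebra_simps power2_eq_square power3_eq_cube power4_eq_xxxx)
  have "(s + d)^4 = s^4 + 4 * (s^3 * d) + 6 * (s\<^sup>2 * d\<^sup>2) + 4 * (s * d^3) + d^4"
    by (simp add: algebra_simps power2_eq_square power3_eq_cube power4_eq_xxxx)
  with * sd d4 show ?thesis by linarith
qed

text \<open>
  The orthogonality assumption gives \<open>E[S\<^sub>n\<^sup>2] \<le> C\<^sup>2 n\<close> and then, by the previous lemma,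
  \<open>E[S\<^sub>n\<^sup>4] \<le> 4 C\<^sup>4 n\<^sup>2\<close>.  Hence \<open>\<Sum>\<^sub>n E[(S\<^sub>n / n)\<^sup>4]\<close> is finite, the series \<open>\<Sum>\<^sub>n (S\<^sub>n / n)\<^sup>4\<close> converges
  almost surely and its terms tend to zero.  Fourth moments rather than second ones make this series
  converge along all \<open>n\<close>, without passing to a subsequence.
\<close>
theorem (in prob_space) bounded_martingale_difference_slln:
  fixes D :: "nat \<Rightarrow> 'a \<Rightarrow> real"
  assumes meas[measurable]: "\<And>n. D n \<in> borel_measurable M"
    and bound: "\<And>n \<omega>. \<bar>D n \<omega>\<bar> \<le> C"
    and orth: "\<And>n k. expectation (\<lambda>\<omega>. (\<Sum>i<n. D i \<omega>) ^ k * D n \<omega>) = 0"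
  shows "AE \<omega> in M. (\<lambda>n. (\<Sum>i<n. D i \<omega>) / real n) \<longlonglongrightarrow> 0"
proof -
  define S where "S n \<omega> = (\<Sum>i<n. D i \<omega>)" for n \<omega>
  have S_meas[measurable]: "S n \<in> borel_measurable M" for n unfolding S_def by measurable
  have S_Suc: "S (Suc n) \<omega> = S n \<omega> + D n \<omega>" for n \<omega> by (simp add: S_def)
  have S_bound: "\<bar>S n \<omega>\<bar> \<le> real n * C" for n \<omega>
    using sum_bounded_above[of "{..<n}" "\<lambda>i. \<bar>D i \<omega>\<bar>" C] sum_abs[of "\<lambda>i. D i \<omega>" "{..<n}"] bound
    by (auto simp: S_def intro: order.trans)
  have int_S: "integrable M (\<lambda>\<omega>. S n \<omega> ^ k)" for n k
    using S_bound[of n]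
    by (intro integrable_const_bound[where B="(real n * C) ^ k"] AE_I2) (auto simp: power_abs intro: power_mono)
  have int_SD: "integrable M (\<lambda>\<omega>. S n \<omega> ^ k * D n \<omega>)" for n k
  proof (intro integrable_const_bound[where B="(real n * C) ^ k * C"] AE_I2)
    show "norm (S n \<omega> ^ k * D n \<omega>) \<le> (real n * C) ^ k * C" for \<omega>
      unfolding real_norm_def abs_mult power_abs
      using S_bound[of n \<omega>] bound[of n \<omega>] by (intro mult_mono power_mono) (auto intro: order.trans)
  qed measurable
  have orth': "expectation (\<lambda>\<omega>. S n \<omega> ^ k * D n \<omega>) = 0" for n k
    using orth[of n k] by (simp add: S_def)
  have moment2: "expectation (\<lambda>\<omega>. (S n \<omega>)\<^sup>2) \<le> C\<^sup>2 * real n" for n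
  proof (induction n)
    case (Suc n)
    have "expectation (\<lambda>\<omega>. (S (Suc n) \<omega>)\<^sup>2)
        \<le> expectation (\<lambda>\<omega>. (S n \<omega>)\<^sup>2 + 2 * (S n \<omega> ^ 1 * D n \<omega>) + C\<^sup>2)"
    proof (rule integral_mono)
      show "(S (Suc n) \<omega>)\<^sup>2 \<le> (S n \<omega>)\<^sup>2 + 2 * (S n \<omega> ^ 1 * D n \<omega>) + C\<^sup>2" for \<omega>
      proof -
        have "(D n \<omega>)\<^sup>2 \<le> C\<^sup>2" using bound[of n \<omega>] by (simp add: abs_le_square_iff[symmetric])
        then show ?thesis by (simp add: S_Suc power2_sum)
      qed
    qed (intro int_S int_SD Bochner_Integration.integrable_add integrable_mult_right integrable_const)+
    also have "\<dots> = expectation (\<lambda>\<omega>. (S n \<omega>)\<^sup>2) + C\<^sup>2"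
      using int_S[of n 2] int_SD[of n 1] orth'[of n 1] by (simp add: prob_space)
    finally show ?case using Suc by (simp add: algebra_simps)
  qed (simp add: S_def)
  have moment4: "expectation (\<lambda>\<omega>. S n \<omega> ^ 4) \<le> 4 * C^4 * (real n)\<^sup>2" for n
  proof (induction n)
    case (Suc n)
    have "expectation (\<lambda>\<omega>. S (Suc n) \<omega> ^ 4)
        \<le> expectation (\<lambda>\<omega>. S n \<omega> ^ 4 + 4 * (S n \<omega> ^ 3 * D n \<omega>) + 8 * C\<^sup>2 * (S n \<omega>)\<^sup>2 + 3 * C^4)"
      unfolding S_Suc
    proof (rule integral_mono)
      show "integrable M (\<lambda>\<omega>. (S n \<omega> + D n \<omega>) ^ 4)"
        using int_S[of "Suc n" 4] by (simp add: S_Suc)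
    qed (intro int_S int_SD Bochner_Integration.integrable_add integrable_mult_right integrable_const
          fourth_power_increment_bound bound)+
    also have "\<dots> = expectation (\<lambda>\<omega>. S n \<omega> ^ 4) + 8 * C\<^sup>2 * expectation (\<lambda>\<omega>. (S n \<omega>)\<^sup>2) + 3 * C^4"
      using int_S[of n 2] int_S[of n 4] int_SD[of n 3] orth'[of n 3] by (simp add: prob_space)
    also have "\<dots> \<le> 4 * C^4 * (real n)\<^sup>2 + 8 * C\<^sup>2 * (C\<^sup>2 * real n) + 3 * C^4"
      by (intro add_mono Suc mult_left_mono moment2) auto
    also have "\<dots> \<le> 4 * C^4 * (real (Suc n))\<^sup>2"
    proof -
      have "0 \<le> C^4" by simp
      moreover have "C\<^sup>2 * (C\<^sup>2 * real n) = C^4 * real n" by (simp add: power4_eq_xxxx power2_eq_square)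
      moreover have "(real (Suc n))\<^sup>2 = (real n)\<^sup>2 + 2 * real n + 1" by (simp add: power2_eq_square algebra_simps)
      ultimately show ?thesis by (simp only: mult.assoc distrib_left)
    qed
    finally show ?case .
  qed (simp add: S_def)
  have "(\<integral>\<^sup>+\<omega>. (\<Sum>n. ennreal ((S n \<omega> / real n) ^ 4)) \<partial>M) = (\<Sum>n. \<integral>\<^sup>+\<omega>. ennreal ((S n \<omega> / real n) ^ 4) \<partial>M)"
    by (rule nn_integral_suminf) measurable
  also have "\<dots> \<le> (\<Sum>n. ennreal (4 * C^4 * (1 / (real n)\<^sup>2)))"
  proof (intro suminf_le summableI)
    fix n
    have "(\<integral>\<^sup>+\<omega>. ennreal ((S n \<omega> / real n) ^ 4) \<partial>M) = ennreal (expectation (\<lambda>\<omega>. (S n \<omega> / real n) ^ 4))"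
      using int_S[of n 4] by (intro nn_integral_eq_integral) (auto simp: power_divide)
    also have "expectation (\<lambda>\<omega>. (S n \<omega> / real n) ^ 4) = expectation (\<lambda>\<omega>. S n \<omega> ^ 4) / real n ^ 4"
      by (simp add: power_divide)
    also have "ennreal \<dots> \<le> ennreal (4 * C^4 * (real n)\<^sup>2 / real n ^ 4)"
      by (intro ennreal_leI divide_right_mono moment4) simp
    also have "4 * C^4 * (real n)\<^sup>2 / real n ^ 4 = 4 * C^4 * (1 / (real n)\<^sup>2)"
      by (simp add: power4_eq_xxxx power2_eq_square)
    finally show "(\<integral>\<^sup>+\<omega>. ennreal ((S n \<omega> / real n) ^ 4) \<partial>M) \<le> ennreal (4 * C^4 * (1 / (real n)\<^sup>2))" .
  qed
  also have "\<dots> < \<infinity>"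
  proof -
    have "summable (\<lambda>n. 4 * C^4 * (1 / (real n)\<^sup>2))"
      using inverse_power_summable[of 2, where 'a=real] by (intro summable_mult) (simp add: divide_inverse)
    then show ?thesis by (subst suminf_ennreal2) auto
  qed
  finally have "AE \<omega> in M. (\<Sum>n. ennreal ((S n \<omega> / real n) ^ 4)) \<noteq> \<infinity>"
    by (intro nn_integral_PInf_AE) auto
  then show ?thesis
  proof eventually_elim
    case (elim \<omega>)
    then have "summable (\<lambda>n. (S n \<omega> / real n) ^ 4)"
      by (intro summable_suminf_not_top) auto
    then have "(\<lambda>n. (S n \<omega> / real n) ^ 4) \<longlonglongrightarrow> 0" by (rule summable_LIMSEQ_zero)
    then have "(\<lambda>n. sqrt (sqrt ((S n \<omega> / real n) ^ 4))) \<longlonglongrightarrow> sqrt (sqrt 0)"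
      by (intro tendsto_real_sqrt)
    moreover have "sqrt (sqrt (x ^ 4)) = \<bar>x\<bar>" for x :: real
    proof -
      have "sqrt (x ^ 4) = x\<^sup>2" using real_sqrt_abs[of "x\<^sup>2"] by simp
      then show ?thesis by simp
    qed
    ultimately have "(\<lambda>n. S n \<omega> / real n) \<longlonglongrightarrow> 0"
      by (intro tendsto_rabs_zero_cancel[where f="\<lambda>n. S n \<omega> / real n"]) simp
    then show ?case by (simp add: S_def)
  qed
qed

section \<open>Measures with prescribed densities on cylinders\<close>

text \<open>
  The condition \<open>\<integral> f\<^sub>n\<^sub>+\<^sub>1(w, v) d\<mu>(v) = f\<^sub>n(w)\<close> is the consistency of the prescribed finite-dimensional laws.
  The measure is built by the Ionescu-Tulcea theorem from the conditional laws of the next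
  coordinate, which have density \<open>f\<^sub>n\<^sub>+\<^sub>1 / f\<^sub>n\<close> with respect to \<open>\<mu>\<close>.
\<close>
theorem ex_prob_space_cylinder_density:
  fixes f :: "nat \<Rightarrow> (nat \<Rightarrow> 'a) \<Rightarrow> ennreal"
  assumes \<mu>: "sigma_finite_measure \<mu>"
    and f[measurable]: "\<And>n. f n \<in> borel_measurable (PiM {..<n} (\<lambda>_. \<mu>))"
    and f0: "f 0 (\<lambda>_. undefined) = 1"
    and fin: "\<And>n w. f n w < \<infinity>"
    and f_Suc: "\<And>n w. w \<in> space (PiM {..<n} (\<lambda>_. \<mu>)) \<Longrightarrow> (\<integral>\<^sup>+v. f (Suc n) (w(n := v)) \<partial>\<mu>) = f n w"
  shows "\<exists>\<P>. prob_space \<P> \<and> sets \<P> = sets (PiM UNIV (\<lambda>_. \<mu>)) \<and>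
    (\<forall>n. \<forall>A\<in>sets (PiM {..<n} (\<lambda>_. \<mu>)).
      emeasure \<P> (prod_emb UNIV (\<lambda>_. \<mu>) {..<n} A) = (\<integral>\<^sup>+w\<in>A. f n w \<partial>PiM {..<n} (\<lambda>_. \<mu>)))"
proof -
  interpret \<mu>: sigma_finite_measure \<mu> by fact
  have "(\<integral>\<^sup>+v. f 1 ((\<lambda>_. undefined)(0 := v)) \<partial>\<mu>) = 1"
    using f_Suc[of "\<lambda>_. undefined" 0] f0 by (simp add: space_PiM)
  then have "space \<mu> \<noteq> {}" by (metis nn_integral_empty zero_neq_one)
  then obtain a where a: "a \<in> space \<mu>" by auto
  interpret product_sigma_finite "\<lambda>_::nat. \<mu>" by unfold_locales
  \<comment> \<open>Where \<open>f n\<close> vanishes the quotient carries no mass; a Dirac measure keeps the kernel stochastic.\<close>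
  define K where "K n w = (if f n w = 0 then return \<mu> a else density \<mu> (\<lambda>v. f (Suc n) (w(n := v)) / f n w))"
    for n w
  have upd[measurable]: "(\<lambda>v. w(n := v)) \<in> measurable \<mu> (PiM {..<Suc n} (\<lambda>_. \<mu>))"
    if "w \<in> space (PiM {..<n} (\<lambda>_. \<mu>))" for w n
    using that by (intro measurable_fun_upd[where J="{..<n}"]) auto
  have f_upd[measurable]: "(\<lambda>v. f (Suc n) (w(n := v))) \<in> borel_measurable \<mu>"
    if "w \<in> space (PiM {..<n} (\<lambda>_. \<mu>))" for w n
    using measurable_compose[OF upd[OF that] f] .
  have upd2[measurable]: "(\<lambda>x. (fst x)(n := snd x)) \<in> measurable (PiM {..<n} (\<lambda>_. \<mu>) \<Otimes>\<^sub>M \<mu>) (PiM {..<Suc n} (\<lambda>_. \<mu>))"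
    for n by (intro measurable_fun_upd[where J="{..<n}"]) auto
  have K_prob: "prob_space (K n w)" if w: "w \<in> space (PiM {..<n} (\<lambda>_. \<mu>))" for n w
  proof (cases "f n w = 0")
    case True then show ?thesis using a by (simp add: K_def prob_space_return)
  next
    case False
    show ?thesis
    proof
      have "emeasure (K n w) (space (K n w)) = (\<integral>\<^sup>+v. f (Suc n) (w(n := v)) / f n w \<partial>\<mu>)"
        using False w by (simp add: K_def emeasure_density cong: nn_integral_cong)
      also have "\<dots> = (\<integral>\<^sup>+v. f (Suc n) (w(n := v)) \<partial>\<mu>) / f n w"
        using w by (simp add: nn_integral_divide)
      also have "\<dots> = 1"
        using False w fin[of n w] by (simp add: f_Suc ennreal_divide_self)
      finally show "emeasure (K n w) (space (K n w)) = 1" .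
    qed
  qed
  have K_sets: "sets (K n w) = sets \<mu>" for n w
    by (simp add: K_def)
  have K_meas: "K n \<in> measurable (PiM {..<n} (\<lambda>_. \<mu>)) (subprob_algebra \<mu>)" for n
  proof (rule measurable_subprob_algebra)
    fix A assume A[measurable]: "A \<in> sets \<mu>"
    have "(\<lambda>w. emeasure (K n w) A) \<in> borel_measurable (PiM {..<n} (\<lambda>_. \<mu>)) \<longleftrightarrow>
      (\<lambda>w. if f n w = 0 then indicator A a else
        \<integral>\<^sup>+v. f (Suc n) (w(n := v)) / f n w * indicator A v \<partial>\<mu>) \<in> borel_measurable (PiM {..<n} (\<lambda>_. \<mu>))"
      by (rule measurable_cong) (auto simp: K_def emeasure_density)
    also have \<dots>
    proof -
      have [measurable]: "(\<lambda>x. f (Suc n) ((fst x)(n := snd x))) \<in> borel_measurable (PiM {..<n} (\<lambda>_. \<mu>) \<Otimes>\<^sub>M \<mu>)"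
        using measurable_compose[OF upd2 f] .
      have "(\<lambda>x. f (Suc n) ((fst x)(n := snd x)) / f n (fst x) * indicator A (snd x))
          \<in> borel_measurable (PiM {..<n} (\<lambda>_. \<mu>) \<Otimes>\<^sub>M \<mu>)"
        by measurable
      then have [measurable]: "(\<lambda>w. \<integral>\<^sup>+v. f (Suc n) (w(n := v)) / f n w * indicator A v \<partial>\<mu>)
          \<in> borel_measurable (PiM {..<n} (\<lambda>_. \<mu>))"
        by (intro \<mu>.borel_measurable_nn_integral) (simp add: case_prod_beta')
      show ?thesis by measurable
    qed
    finally show "(\<lambda>w. emeasure (K n w) A) \<in> borel_measurable (PiM {..<n} (\<lambda>_. \<mu>))" .
  qed (simp_all add: K_prob K_sets prob_space_imp_subprob_space)
  interpret IT: Ionescu_Tulcea K "\<lambda>_. \<mu>"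
    by (rule Ionescu_Tulcea.intro) (simp_all add: atLeast0LessThan K_meas K_prob)
  have C: "emeasure (IT.C 0 n (\<lambda>_. undefined)) A = (\<integral>\<^sup>+w\<in>A. f n w \<partial>PiM {..<n} (\<lambda>_. \<mu>))"
    if "A \<in> sets (PiM {..<n} (\<lambda>_. \<mu>))" for n A
    using that
  proof (induction n arbitrary: A)
    case 0
    then show ?case by (simp add: PiM_empty f0 nn_integral_count_space_finite)
  next
    case (Suc n)
    note A[measurable] = Suc.prems
    let ?C = "IT.C 0 n (\<lambda>_. undefined)" and ?N = "PiM {..<n} (\<lambda>_. \<mu>)"
    have C_eq: "?C = density ?N (f n)"
      by (rule measure_eqI)
         (simp_all add: Suc.IH IT.sets_C atLeast0LessThan emeasure_density mult.commute)
    have step: "f n w * emeasure (IT.eP n w) A = (\<integral>\<^sup>+v. f (Suc n) (w(n := v)) * indicator A (w(n := v)) \<partial>\<mu>)"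
      if w: "w \<in> space ?N" for w
    proof -
      have ind[measurable]: "(\<lambda>v. indicator A (w(n := v)) :: ennreal) \<in> borel_measurable \<mu>"
        using measurable_compose[OF upd[OF w] borel_measurable_indicator[OF A]] .
      have "emeasure (IT.eP n w) A = (\<integral>\<^sup>+v. indicator A (w(n := v)) \<partial>K n w)"
        using IT.nn_integral_eP[of w n "indicator A"] w A IT.sets_eP[of w n]
        by (simp add: atLeast0LessThan nn_integral_indicator)
      also have "f n w * \<dots> = (\<integral>\<^sup>+v. f (Suc n) (w(n := v)) * indicator A (w(n := v)) \<partial>\<mu>)"
      proof (cases "f n w = 0")
        case True
        then have "(\<integral>\<^sup>+v. f (Suc n) (w(n := v)) \<partial>\<mu>) = 0" using f_Suc[OF w] by simp
        then have "AE v in \<mu>. f (Suc n) (w(n := v)) = 0"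
          using w by (simp add: nn_integral_0_iff_AE)
        then have "(\<integral>\<^sup>+v. f (Suc n) (w(n := v)) * indicator A (w(n := v)) \<partial>\<mu>) = (\<integral>\<^sup>+v. 0 \<partial>\<mu>)"
          by (intro nn_integral_cong_AE) auto
        then show ?thesis using True by simp
      next
        case False
        have "f n w * (\<integral>\<^sup>+v. indicator A (w(n := v)) \<partial>K n w) =
            f n w * (\<integral>\<^sup>+v. f (Suc n) (w(n := v)) / f n w * indicator A (w(n := v)) \<partial>\<mu>)"
          using False w by (simp add: K_def nn_integral_density)
        also have "\<dots> = (\<integral>\<^sup>+v. f n w * (f (Suc n) (w(n := v)) / f n w * indicator A (w(n := v))) \<partial>\<mu>)"
          using w by (intro nn_integral_cmult[symmetric]) measurable
        also have "\<dots> = (\<integral>\<^sup>+v. f (Suc n) (w(n := v)) * indicator A (w(n := v)) \<partial>\<mu>)"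
        proof (rule nn_integral_cong)
          fix v
          have "f n w * (f (Suc n) (w(n := v)) / f n w) = f (Suc n) (w(n := v))"
            using False fin[of n w] by (simp add: ennreal_times_divide mult.commute[of "f n w"] mult_divide_eq_ennreal)
          then show "f n w * (f (Suc n) (w(n := v)) / f n w * indicator A (w(n := v))) =
              f (Suc n) (w(n := v)) * indicator A (w(n := v))"
            by (simp add: mult.assoc[symmetric])
        qed
        finally show ?thesis .
      qed
      finally show ?thesis .
    qed
    have eP_meas: "IT.eP n \<in> measurable ?N (subprob_algebra (PiM {..<Suc n} (\<lambda>_. \<mu>)))"
      using IT.measurable_eP[of n] by (simp add: atLeast0LessThan)
    have [measurable]: "(\<lambda>w. emeasure (IT.eP n w) A) \<in> borel_measurable ?N"
      using measurable_compose[OF eP_meas measurable_emeasure_subprob_algebra[OF A]] .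
    have "emeasure (IT.C 0 (Suc n) (\<lambda>_. undefined)) A = emeasure (?C \<bind> IT.eP n) A"
      by simp
    also have "\<dots> = (\<integral>\<^sup>+w. emeasure (IT.eP n w) A \<partial>?C)"
      using eP_meas A by (intro emeasure_bind[where N="PiM {..<Suc n} (\<lambda>_. \<mu>)"])
        (simp_all add: IT.space_C atLeast0LessThan C_eq)
    also have "\<dots> = (\<integral>\<^sup>+w. f n w * emeasure (IT.eP n w) A \<partial>?N)"
      unfolding C_eq by (rule nn_integral_density) measurable
    also have "\<dots> = (\<integral>\<^sup>+w. \<integral>\<^sup>+v. f (Suc n) (w(n := v)) * indicator A (w(n := v)) \<partial>\<mu> \<partial>?N)"
      by (intro nn_integral_cong step)
    also have "\<dots> = (\<integral>\<^sup>+w\<in>A. f (Suc n) w \<partial>PiM (insert n {..<n}) (\<lambda>_. \<mu>))"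
      using f[of "Suc n"] A by (intro product_nn_integral_insert[symmetric]) (auto simp flip: lessThan_Suc)
    finally show ?case by (simp add: lessThan_Suc)
  qed
  show ?thesis
  proof (intro exI[of _ IT.PF.lim] conjI allI ballI)
    show "prob_space IT.PF.lim"
    proof
      have "space IT.PF.lim = prod_emb UNIV (\<lambda>_. \<mu>) {} (space (PiM {} (\<lambda>_. \<mu>)))"
        by (auto simp: prod_emb_def IT.PF.space_lim space_PiM restrict_def)
      also have "emeasure IT.PF.lim \<dots> = emeasure (IT.CI {}) (space (PiM {} (\<lambda>_. \<mu>)))"
        by (rule IT.lim) auto
      also have "\<dots> = 1"
        using prob_space.emeasure_space_1[OF IT.PF.prob_space_P[of "{}"]] by (simp add: IT.PF.space_P)
      finally show "emeasure IT.PF.lim (space IT.PF.lim) = 1" .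
    qed
    show "sets IT.PF.lim = sets (PiM UNIV (\<lambda>_. \<mu>))" by simp
    fix n :: nat and A assume A: "A \<in> sets (PiM {..<n} (\<lambda>_. \<mu>))"
    have "emeasure IT.PF.lim (prod_emb UNIV (\<lambda>_. \<mu>) {..<n} A) = emeasure (IT.CI {..<n}) A"
      using A by (intro IT.lim) auto
    also have "\<dots> = emeasure (IT.C 0 n (\<lambda>_. undefined)) (prod_emb {0..<n} (\<lambda>_. \<mu>) {..<n} A)"
      using A by (intro IT.emeasure_CI) auto
    also have "prod_emb {0..<n} (\<lambda>_. \<mu>) {..<n} A = A"
      using sets.sets_into_space[OF A] by (simp add: atLeast0LessThan prod_emb_id space_PiM)
    finally show "emeasure IT.PF.lim (prod_emb UNIV (\<lambda>_. \<mu>) {..<n} A) = (\<integral>\<^sup>+w\<in>A. f n w \<partial>PiM {..<n} (\<lambda>_. \<mu>))"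
      using C[OF A] by simp
  qed
qed

text \<open>
  Every finite-dimensional rectangle depends on an initial segment of coordinates, and these
  rectangles form an intersection-stable generator.
\<close>
lemma is_path_measure_unique:
  fixes \<P> \<Q> :: "(nat \<Rightarrow> complex^'n^'n) measure"
  assumes "is_path_measure L \<mu> \<rho> \<P>" and "is_path_measure L \<mu> \<rho> \<Q>"
  shows "\<P> = \<Q>"
proof (rule measure_eqI_PiM_infinite[where I=UNIV and M="\<lambda>_. borel"])
  fix F :: "nat \<Rightarrow> (complex^'n^'n) set" and J :: "nat set"
  assume J: "finite J" and F: "\<And>i. i \<in> J \<Longrightarrow> F i \<in> sets borel"
  obtain n where n: "J \<subseteq> {..<n}"
    using finite_nat_bounded[OF J] by auto
  have cyl: "prod_emb UNIV (\<lambda>_. borel) J (Pi\<^sub>E J F) =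
      prod_emb UNIV (\<lambda>_. borel) {..<n} (prod_emb {..<n} (\<lambda>_. borel) J (Pi\<^sub>E J F))"
    using n by simp
  have "prod_emb {..<n} (\<lambda>_. borel) J (Pi\<^sub>E J F) \<in> sets (PiM {..<n} (\<lambda>_. borel))"
    using n J F by (intro measurable_prod_emb sets_PiM_I_finite) auto
  then show "emeasure \<P> (prod_emb UNIV (\<lambda>_. borel) J (Pi\<^sub>E J F)) =
      emeasure \<Q> (prod_emb UNIV (\<lambda>_. borel) J (Pi\<^sub>E J F))"
    unfolding cyl using assms by (simp add: is_path_measure_def)
qed (use assms in \<open>auto simp: is_path_measure_def prob_space.finite_measure\<close>)

lemma path_measure_eqI:
  assumes "is_path_measure L \<mu> \<rho> \<P>"
  shows "path_measure L \<mu> \<rho> = \<P>"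
  unfolding path_measure_def using assms by (rule the_equality) (rule is_path_measure_unique[OF _ assms])

section \<open>Matrix units and Kraus operators\<close>

lemma conj_transpose_mult: "conj_transpose (A ** B) = conj_transpose B ** conj_transpose A"
  by (simp add: vec_eq_iff conj_transpose_def matrix_matrix_mult_def mult.commute)

lemma matrix_product_cong:
  assumes "\<And>k. k < n \<Longrightarrow> w k = w' k"
  shows "matrix_product L n w = matrix_product L n w'"
  using assms by (induction n) simp_all

lemma borel_measurable_matrix_product:
  fixes N :: "(nat \<Rightarrow> complex^'n^'n) measure"
  assumes "\<And>k. k < n \<Longrightarrow> (\<lambda>w. w k) \<in> borel_measurable N"
  shows "matrix_product (\<lambda>v. v) n \<in> borel_measurable N"
  using assms
proof (induction n)
  case 0
  show ?case by (simp only: matrix_product.simps(1)[abs_def] borel_measurable_const)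
next
  case (Suc n)
  have "(\<lambda>w. w n) \<in> borel_measurable N" and "matrix_product (\<lambda>v. v) n \<in> borel_measurable N"
    by (rule Suc.prems, simp) (rule Suc.IH, rule Suc.prems, simp)
  moreover have "continuous_on UNIV (\<lambda>x::(complex^'n^'n) \<times> (complex^'n^'n). fst x ** snd x)"
    unfolding matrix_matrix_mult_def by (intro continuous_intros)
  ultimately have "(\<lambda>w. w n ** matrix_product (\<lambda>v. v) n w) \<in> borel_measurable N"
    by (rule borel_measurable_continuous_Pair[where H="(**)"])
  then show ?case by (simp only: matrix_product.simps(2)[abs_def])
qed

lemma diag_conjugation_diagonal:
  "(A ** diag_matrix d ** conj_transpose A) $ j $ j = complex_of_real (\<Sum>k\<in>UNIV. d $ k * (cmod (A $ j $ k))\<^sup>2)"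
proof -
  have 1: "(A ** diag_matrix d) $ j $ k = A $ j $ k * complex_of_real (d $ k)" for k
  proof -
    have "(A ** diag_matrix d) $ j $ k = (\<Sum>l\<in>UNIV. if l = k then A $ j $ k * complex_of_real (d $ k) else 0)"
      unfolding matrix_matrix_mult_def diag_matrix_def vec_lambda_beta by (intro sum.cong) auto
    then show ?thesis by simp
  qed
  have "(A ** diag_matrix d ** conj_transpose A) $ j $ j =
      (\<Sum>k\<in>UNIV. (A ** diag_matrix d) $ j $ k * cnj (A $ j $ k))"
    by (simp add: matrix_matrix_mult_def[of "A ** diag_matrix d"] conj_transpose_def)
  also have "\<dots> = (\<Sum>k\<in>UNIV. complex_of_real (d $ k * (cmod (A $ j $ k))\<^sup>2))"
  proof (rule sum.cong)
    show "(A ** diag_matrix d) $ j $ k * cnj (A $ j $ k) = complex_of_real (d $ k * (cmod (A $ j $ k))\<^sup>2)" for k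
      unfolding 1 by (simp only: of_real_mult complex_norm_square) (simp add: mult_ac)
  qed simp
  finally show ?thesis by simp
qed

lemma scaled_matrix_unit_entry:
  "(c *\<^sub>R matrix_unit i j) $ a $ b = (if a = i \<and> b = j then complex_of_real c else 0)"
  by (simp add: matrix_unit_def) (simp add: scaleR_conv_of_real)

lemma markov_kraus_entry:
  "markov_kraus P i j $ a $ b = (if a = i \<and> b = j then complex_of_real (sqrt (P $ i $ j)) else 0)"
  unfolding markov_kraus_def by (rule scaled_matrix_unit_entry)

lemma finite_measure_markov_kraus: "finite_measure (markov_kraus_measure P)"
  unfolding markov_kraus_measure_eq_distr
  by (intro finite_measure.finite_measure_distr finite_measure_count_space) auto

lemma space_markov_kraus_measure [simp]: "space (markov_kraus_measure P) = UNIV"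
  using sets_eq_imp_space_eq[OF sets_markov_kraus_measure] by simp

lemma nn_integral_markov_kraus:
  fixes P :: "real^'n^'n"
  assumes "h \<in> borel_measurable borel"
  shows "(\<integral>\<^sup>+v. h v \<partial>markov_kraus_measure P) = (\<Sum>j\<in>UNIV. \<Sum>i\<in>UNIV. h (markov_kraus P i j))"
proof -
  have "(\<integral>\<^sup>+v. h v \<partial>markov_kraus_measure P) = (\<Sum>(i, j)\<in>UNIV \<times> UNIV. h (markov_kraus P i j))"
    unfolding markov_kraus_measure_eq_distr using assms
    by (subst nn_integral_distr) (auto simp: nn_integral_count_space_finite case_prod_unfold simp flip: UNIV_Times_UNIV)
  also have "\<dots> = (\<Sum>i\<in>UNIV. \<Sum>j\<in>UNIV. h (markov_kraus P i j))"
    by (rule sum.cartesian_product[symmetric])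
  also have "\<dots> = (\<Sum>j\<in>UNIV. \<Sum>i\<in>UNIV. h (markov_kraus P i j))"
    by (rule sum.swap)
  finally show ?thesis .
qed

lemma integral_markov_kraus:
  fixes P :: "real^'n^'n" and h :: "complex^'n^'n \<Rightarrow> real"
  assumes "h \<in> borel_measurable borel"
  shows "(\<integral>v. h v \<partial>markov_kraus_measure P) = (\<Sum>j\<in>UNIV. \<Sum>i\<in>UNIV. h (markov_kraus P i j))"
proof -
  have "(\<integral>v. h v \<partial>markov_kraus_measure P) = (\<Sum>(i, j)\<in>UNIV \<times> UNIV. h (markov_kraus P i j))"
    unfolding markov_kraus_measure_eq_distr using assms
    by (subst integral_distr) (auto simp: lebesgue_integral_count_space_finite case_prod_unfold simp flip: UNIV_Times_UNIV)
  also have "\<dots> = (\<Sum>i\<in>UNIV. \<Sum>j\<in>UNIV. h (markov_kraus P i j))"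
    by (rule sum.cartesian_product[symmetric])
  also have "\<dots> = (\<Sum>j\<in>UNIV. \<Sum>i\<in>UNIV. h (markov_kraus P i j))"
    by (rule sum.swap)
  finally show ?thesis .
qed

lemma operator_norm_matrix_unit:
  fixes i j :: "'n::finite"
  shows "operator_norm (c *\<^sub>R matrix_unit i j) = \<bar>c\<bar>"
proof -
  let ?A = "c *\<^sub>R matrix_unit i j :: complex^'n^'n"
  have entry: "(?A *v x) $ a = (if a = i then c *\<^sub>R x $ j else 0)" for x a
  proof -
    have "(?A *v x) $ a = (\<Sum>b\<in>UNIV. if b = j then if a = i then c *\<^sub>R x $ j else 0 else 0)"
      unfolding matrix_vector_mult_def vec_lambda_beta
      by (intro sum.cong) (auto simp: matrix_unit_def)
    then show ?thesis by simp
  qed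
  have norm: "norm (?A *v x) = \<bar>c\<bar> * cmod (x $ j)" for x
  proof -
    have "norm (?A *v x) = L2_set (\<lambda>a. if a = i then \<bar>c\<bar> * cmod (x $ j) else 0) UNIV"
      unfolding norm_vec_def by (intro L2_set_cong) (auto simp: entry)
    also have "\<dots> = sqrt (\<Sum>a\<in>UNIV. if a = i then (\<bar>c\<bar> * cmod (x $ j))\<^sup>2 else 0)"
      unfolding L2_set_def by (intro arg_cong[where f=sqrt] sum.cong) auto
    finally show ?thesis by simp
  qed
  have "onorm (\<lambda>x. ?A *v x) \<le> \<bar>c\<bar>"
    by (rule onorm_bound) (simp_all add: norm mult_left_mono Finite_Cartesian_Product.norm_nth_le)
  moreover have "\<bar>c\<bar> \<le> onorm (\<lambda>x. ?A *v x)"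
  proof -
    have "norm (?A *v axis j 1) \<le> onorm (\<lambda>x. ?A *v x) * norm (axis j 1 :: complex^'n)"
      by (rule onorm) (rule matrix_vector_mul_bounded_linear)
    moreover have "norm (axis j 1 :: complex^'n) = 1"
    proof -
      have "norm (axis j 1 :: complex^'n) = sqrt (\<Sum>a\<in>UNIV. if a = j then 1 else 0)"
        unfolding norm_vec_def L2_set_def by (intro arg_cong[where f=sqrt] sum.cong) (auto simp: axis_def)
      then show ?thesis by simp
    qed
    ultimately show ?thesis by (simp add: norm)
  qed
  ultimately show ?thesis by (simp add: operator_norm_def)
qed

text \<open>
  A multiple \<open>A\<close> of a matrix unit has the Gram matrix \<open>c\<^sup>2 E\<^sub>j\<^sub>j\<close>, whose characteristic polynomial
  is \<open>z (z - c\<^sup>2)\<close>.  Evaluating the factorisation at two points determines the list uniquely.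
\<close>
lemma singular_values_matrix_unit:
  fixes i j :: 2
  shows "singular_values (c *\<^sub>R matrix_unit i j) = [\<bar>c\<bar>, 0]"
proof -
  let ?A = "c *\<^sub>R matrix_unit i j :: complex^2^2"
  have gram: "conj_transpose ?A ** ?A = (\<chi> a b. if a = j \<and> b = j then complex_of_real (c\<^sup>2) else 0)"
    using exhaust_2[of i] exhaust_2[of j]
    by (auto simp: vec_eq_iff forall_2 matrix_matrix_mult_def sum_2 conj_transpose_def
        scaled_matrix_unit_entry power2_eq_square simp del: vector_scaleR_component)
  have det: "det (mat z - conj_transpose ?A ** ?A) = z * (z - complex_of_real (c\<^sup>2))" for z
    unfolding gram using exhaust_2[of j] by (auto simp: det_2 mat_def)
  have "length as = 2 \<and> sorted_wrt (\<ge>) as \<and> (\<forall>a\<in>set as. 0 \<le> a) \<and>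
      (\<forall>z. z * (z - complex_of_real (c\<^sup>2)) = (\<Prod>a\<leftarrow>as. z - complex_of_real (a\<^sup>2))) \<longleftrightarrow> as = [\<bar>c\<bar>, 0]"
    (is "?L as \<longleftrightarrow> _") for as
  proof
    assume L: "?L as"
    then obtain s t where as: "as = [s, t]"
      by (auto simp: length_Suc_conv numeral_2_eq_2)
    have st: "t \<le> s" "0 \<le> t" "0 \<le> s" using L by (auto simp: as)
    have eq: "z * (z - complex_of_real (c\<^sup>2)) = (z - complex_of_real (s\<^sup>2)) * (z - complex_of_real (t\<^sup>2))" for z
      using L by (simp add: as)
    have "complex_of_real (s\<^sup>2 * t\<^sup>2) = 0" using eq[of 0] by simp
    then have "s = 0 \<or> t = 0" by (simp only: of_real_eq_0_iff) simp
    then have t: "t = 0" using st by auto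
    have "complex_of_real (s\<^sup>2 - c\<^sup>2) = 0" using eq[of 1] by (simp add: t)
    then have "s\<^sup>2 = c\<^sup>2" by (simp only: of_real_eq_0_iff right_minus_eq)
    then have "s = \<bar>c\<bar>" using st by (auto simp: power2_eq_iff)
    then show "as = [\<bar>c\<bar>, 0]" by (simp add: as t)
  qed (simp add: mult.commute flip: of_real_power)
  then show ?thesis
    unfolding singular_values_def det by simp
qed

lemma ext_power_norm_matrix_unit:
  fixes i j :: 2
  shows "ext_power_norm 2 (c *\<^sub>R matrix_unit i j) = 0"
  by (simp add: ext_power_norm_def singular_values_matrix_unit)

section \<open>The path measure of a Markov chain\<close>

text \<open>
  The Markov chain with transition matrix \<open>P\<close> and initial distribution \<open>p\<close>, seen through the
  Kraus operators of its transitions: the \<open>j\<close>-th diagonal entry of \<open>state n w\<close> is the probability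
  that the first \<open>n\<close> transitions are those encoded by \<open>w\<close> and lead to \<open>j\<close>.
\<close>
locale kraus_chain =
  fixes P :: "real^'n^'n" and p :: "real^'n"
  assumes stochastic: "column_stochastic P"
    and p_nonneg: "\<And>i. 0 \<le> p $ i"
    and p_sum: "(\<Sum>i\<in>UNIV. p $ i) = 1"
begin

abbreviation V where "V \<equiv> markov_kraus P"
abbreviation \<mu> where "\<mu> \<equiv> markov_kraus_measure P"
abbreviation W where "W \<equiv> matrix_product (\<lambda>v::complex^'n^'n. v)"

definition state :: "nat \<Rightarrow> (nat \<Rightarrow> complex^'n^'n) \<Rightarrow> complex^'n^'n" where
  "state n w = W n w ** diag_matrix p ** conj_transpose (W n w)"

definition weight :: "nat \<Rightarrow> (nat \<Rightarrow> complex^'n^'n) \<Rightarrow> real" where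
  "weight n w = Re (trace (state n w))"

abbreviation path :: "(nat \<Rightarrow> complex^'n^'n) measure" where
  "path \<equiv> path_measure (\<lambda>v. v) \<mu> (diag_matrix p)"

sublocale product_sigma_finite "\<lambda>_::nat. \<mu>"
  by (intro product_sigma_finite.intro finite_measure.axioms(1) finite_measure_markov_kraus)

lemma P_nonneg: "0 \<le> P $ i $ j" and P_col_sum: "(\<Sum>i\<in>UNIV. P $ i $ j) = 1"
  using stochastic by (auto simp: column_stochastic_def)

lemma state_nonneg: "0 \<le> Re (state n w $ j $ j)"
  unfolding state_def diag_conjugation_diagonal using p_nonneg by (auto intro!: sum_nonneg)

lemma weight_eq_sum: "weight n w = (\<Sum>j\<in>UNIV. Re (state n w $ j $ j))"
  by (simp add: weight_def trace_def)

lemma weight_nonneg: "0 \<le> weight n w"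
  by (simp add: weight_eq_sum sum_nonneg state_nonneg)

lemma weight_0: "weight 0 w = 1"
proof -
  have "weight 0 w = (\<Sum>j\<in>UNIV. \<Sum>k\<in>UNIV. p $ k * (cmod (mat 1 $ j $ k :: complex))\<^sup>2)"
    unfolding weight_eq_sum state_def diag_conjugation_diagonal by simp
  also have "\<dots> = (\<Sum>j\<in>UNIV. \<Sum>k\<in>UNIV. if k = j then p $ j else 0)"
    by (intro sum.cong refl) (auto simp: mat_def)
  finally show ?thesis by (simp add: p_sum)
qed

text \<open>
  Appending the transition \<open>j \<rightarrow> i\<close> multiplies the weight of being in \<open>j\<close> by \<open>p\<^sub>i\<^sub>j\<close>: this is the Markov
  property of the path measure.  It holds for every \<open>w\<close>, not only for admissible ones, because the
  conjugation by \<open>V i j\<close> reads off a single diagonal entry.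
\<close>
lemma weight_upd:
  "weight (Suc n) (w(n := V i j)) = P $ i $ j * Re (state n w $ j $ j)"
proof -
  have "W n (w(n := V i j)) = W n w" by (rule matrix_product_cong) simp
  then have "state (Suc n) (w(n := V i j)) = V i j ** state n w ** conj_transpose (V i j)"
    by (simp add: state_def conj_transpose_mult matrix_mul_assoc)
  then have "weight (Suc n) (w(n := V i j)) =
      Re (\<Sum>a\<in>UNIV. if a = i then complex_of_real (P $ i $ j) * state n w $ j $ j else 0)"
    unfolding weight_def trace_def by (simp add: markov_kraus_conjugation P_nonneg)
  then show ?thesis by simp
qed

lemma weight_measurable: "weight n \<in> borel_measurable (PiM {..<n} (\<lambda>_. borel))"
proof -
  have 1: "W n \<in> borel_measurable (PiM {..<n} (\<lambda>_. borel))"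
    by (rule borel_measurable_matrix_product) measurable
  have "continuous_on UNIV (\<lambda>A. Re (trace (A ** diag_matrix p ** conj_transpose A)))"
    unfolding matrix_matrix_mult_def conj_transpose_def trace_def by (intro continuous_intros)
  then have "(\<lambda>A. Re (trace (A ** diag_matrix p ** conj_transpose A))) \<in> borel_measurable borel"
    by (rule borel_measurable_continuous_onI)
  from measurable_compose[OF 1 this] show ?thesis
    by (simp add: weight_def[abs_def] state_def)
qed

lemma sets_PiM_kraus: "sets (PiM I (\<lambda>_. \<mu>)) = sets (PiM I (\<lambda>_. borel))"
  by (rule sets_PiM_cong) simp_all

lemma measurable_PiM_kraus: "measurable (PiM I (\<lambda>_. \<mu>)) N = measurable (PiM I (\<lambda>_. borel)) N"
  by (rule measurable_cong_sets[OF sets_PiM_kraus refl])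

lemma upd_measurable:
  assumes "h \<in> measurable (PiM {..<Suc n} (\<lambda>_. borel)) N" and "w \<in> space (PiM {..<n} (\<lambda>_. \<mu>))"
  shows "(\<lambda>v. h (w(n := v))) \<in> measurable borel N"
proof -
  have "(\<lambda>v. w(n := v)) \<in> measurable borel (PiM {..<Suc n} (\<lambda>_. borel))"
  proof (rule measurable_fun_upd[where J="{..<n}"])
    show "{..<Suc n} = {..<n} \<union> {n}" by auto
    have "w \<in> space (PiM {..<n} (\<lambda>_. borel))" using assms(2) by (simp add: space_PiM)
    then show "(\<lambda>v. w) \<in> measurable borel (PiM {..<n} (\<lambda>_. borel))" by (rule measurable_const)
  qed simp
  from measurable_compose[OF this assms(1)] show ?thesis .
qed

text \<open>
  The definition of \<open>path\<close> is by unique description, so existence has to be shown first.  Consistency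
  of the weights is trace preservation of the channel, that is, \<open>P\<close> being column-stochastic.
\<close>
lemma is_path_measure_path: "is_path_measure (\<lambda>v. v) \<mu> (diag_matrix p) path"
proof -
  have total: "(\<integral>\<^sup>+v. ennreal (weight (Suc n) (w(n := v))) \<partial>\<mu>) = ennreal (weight n w)"
    if w: "w \<in> space (PiM {..<n} (\<lambda>_. \<mu>))" for n w
  proof -
    have "(\<integral>\<^sup>+v. ennreal (weight (Suc n) (w(n := v))) \<partial>\<mu>) =
        (\<Sum>j\<in>UNIV. \<Sum>i\<in>UNIV. ennreal (weight (Suc n) (w(n := V i j))))"
      using upd_measurable[OF weight_measurable w] by (intro nn_integral_markov_kraus) simp
    also have "\<dots> = ennreal (\<Sum>j\<in>UNIV. \<Sum>i\<in>UNIV. P $ i $ j * Re (state n w $ j $ j))"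
      by (simp add: weight_upd sum_ennreal sum_nonneg P_nonneg state_nonneg)
    also have "(\<Sum>j\<in>UNIV. \<Sum>i\<in>UNIV. P $ i $ j * Re (state n w $ j $ j)) = weight n w"
      by (simp add: weight_eq_sum sum_distrib_right[symmetric] P_col_sum)
    finally show ?thesis .
  qed
  have "\<exists>\<P>. prob_space \<P> \<and> sets \<P> = sets (PiM UNIV (\<lambda>_. \<mu>)) \<and>
      (\<forall>n. \<forall>A\<in>sets (PiM {..<n} (\<lambda>_. \<mu>)).
        emeasure \<P> (prod_emb UNIV (\<lambda>_. \<mu>) {..<n} A) = (\<integral>\<^sup>+w\<in>A. ennreal (weight n w) \<partial>PiM {..<n} (\<lambda>_. \<mu>)))"
  proof (rule ex_prob_space_cylinder_density)
    show "sigma_finite_measure \<mu>" by (rule sigma_finite_measures)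
    show "(\<lambda>w. ennreal (weight n w)) \<in> borel_measurable (PiM {..<n} (\<lambda>_. \<mu>))" for n
      unfolding measurable_PiM_kraus using weight_measurable by (rule measurable_compose) simp
  qed (simp_all add: weight_0 total)
  moreover have "prod_emb UNIV (\<lambda>_::nat. \<mu>) J A = prod_emb UNIV (\<lambda>_. borel) J A" for J A
    by (simp add: prod_emb_def)
  ultimately obtain \<P> where "is_path_measure (\<lambda>v. v) \<mu> (diag_matrix p) \<P>"
    unfolding is_path_measure_def sets_PiM_kraus weight_def state_def by auto
  then show ?thesis by (simp add: path_measure_eqI)
qed

lemma prob_space_path: "prob_space path" and sets_path: "sets path = sets (PiM UNIV (\<lambda>_. borel))"
  using is_path_measure_path by (simp_all add: is_path_measure_def)

lemma restrict_path_measurable: "(\<lambda>w. restrict w {..<n}) \<in> measurable path (PiM {..<n} (\<lambda>_. borel))"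
  unfolding measurable_cong_sets[OF sets_path refl] by (rule measurable_restrict_subset) simp

lemma distr_path_restrict:
  "distr path (PiM {..<n} (\<lambda>_. borel)) (\<lambda>w. restrict w {..<n}) =
    density (PiM {..<n} (\<lambda>_. \<mu>)) (\<lambda>w. ennreal (weight n w))"
proof (rule measure_eqI)
  fix A assume "A \<in> sets (distr path (PiM {..<n} (\<lambda>_. borel)) (\<lambda>w. restrict w {..<n}))"
  then have A: "A \<in> sets (PiM {..<n} (\<lambda>_. borel))" by simp
  have "space path = UNIV" using sets_eq_imp_space_eq[OF sets_path] by (simp add: space_PiM)
  then have "emeasure (distr path (PiM {..<n} (\<lambda>_. borel)) (\<lambda>w. restrict w {..<n})) A =
      emeasure path (prod_emb UNIV (\<lambda>_. borel) {..<n} A)"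
    using A by (simp add: emeasure_distr restrict_path_measurable prod_emb_def)
  also have "\<dots> = (\<integral>\<^sup>+w\<in>A. ennreal (weight n w) \<partial>PiM {..<n} (\<lambda>_. \<mu>))"
    using is_path_measure_path A by (simp add: is_path_measure_def weight_def state_def)
  also have "\<dots> = emeasure (density (PiM {..<n} (\<lambda>_. \<mu>)) (\<lambda>w. ennreal (weight n w))) A"
    using A weight_measurable by (simp add: emeasure_density sets_PiM_kraus measurable_PiM_kraus)
  finally show "emeasure (distr path (PiM {..<n} (\<lambda>_. borel)) (\<lambda>w. restrict w {..<n})) A =
      emeasure (density (PiM {..<n} (\<lambda>_. \<mu>)) (\<lambda>w. ennreal (weight n w))) A" .
qed (simp add: sets_PiM_kraus)

section \<open>A law of large numbers for the transitions\<close>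

text \<open>
  The transition \<open>j \<rightarrow> i\<close> is recovered from the matrix \<open>V i j\<close> as the position of its nonzero entry, which
  makes a function \<open>d\<close> of transitions into a bounded measurable function of matrices.
\<close>
definition edge_observable :: "('n \<Rightarrow> 'n \<Rightarrow> real) \<Rightarrow> complex^'n^'n \<Rightarrow> real" where
  "edge_observable d v = (\<Sum>i\<in>UNIV. \<Sum>j\<in>UNIV. if v $ i $ j \<noteq> 0 then d i j else 0)"

lemma edge_observable_markov_kraus:
  "edge_observable d (V i j) = (if P $ i $ j = 0 then 0 else d i j)"
proof -
  have "edge_observable d (V i j) =
      (\<Sum>a\<in>UNIV. \<Sum>b\<in>UNIV. if b = j then if a = i then if P $ i $ j = 0 then 0 else d i j else 0 else 0)"
    unfolding edge_observable_def by (intro sum.cong refl) (auto simp: markov_kraus_entry)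
  then show ?thesis by simp
qed

lemma edge_observable_measurable: "edge_observable d \<in> borel_measurable borel"
proof -
  have "(\<lambda>v::complex^'n^'n. v $ i $ j) \<in> borel_measurable borel" for i j
    by (intro borel_measurable_continuous_onI continuous_intros)
  then have [measurable]: "Measurable.pred borel (\<lambda>v::complex^'n^'n. v $ i $ j \<noteq> 0)" for i j
    by measurable
  show ?thesis unfolding edge_observable_def by measurable
qed

lemma edge_observable_bound: "\<bar>edge_observable d v\<bar> \<le> (\<Sum>i\<in>UNIV. \<Sum>j\<in>UNIV. \<bar>d i j\<bar>)"
  unfolding edge_observable_def
  by (intro order.trans[OF sum_abs] sum_mono) auto

text \<open>
  If \<open>d\<close> has conditional mean zero given the state of departure, then \<open>d\<close> along the path is a
  martingale difference sequence.  The orthogonality is computed from the cylinder densities: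
  integrating out the last coordinate produces the factor \<open>\<Sum>i. P i j * d i j\<close>.
\<close>
theorem edge_observable_slln:
  assumes mean: "\<And>j. (\<Sum>i\<in>UNIV. P $ i $ j * d i j) = 0"
  shows "AE w in path. (\<lambda>n. (\<Sum>k<n. edge_observable d (w k)) / real n) \<longlonglongrightarrow> 0"
proof -
  interpret path: prob_space path by (rule prob_space_path)
  define D where "D = edge_observable d"
  define B where "B = (\<Sum>i\<in>UNIV. \<Sum>j\<in>UNIV. \<bar>d i j\<bar>)"
  have D_bound: "\<bar>D v\<bar> \<le> B" for v unfolding D_def B_def by (rule edge_observable_bound)
  have D_meas[measurable]: "D \<in> borel_measurable borel" unfolding D_def by (rule edge_observable_measurable)
  have coord: "(\<lambda>w. w k) \<in> borel_measurable path" for k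
    unfolding measurable_cong_sets[OF sets_path refl] by measurable
  show ?thesis
    unfolding D_def[symmetric]
  proof (rule path.bounded_martingale_difference_slln)
    show "(\<lambda>w. D (w n)) \<in> borel_measurable path" for n
      using measurable_compose[OF coord D_meas] .
    show "\<bar>D (w n)\<bar> \<le> B" for w :: "nat \<Rightarrow> complex^'n^'n" and n by (rule D_bound)
    fix n m
    let ?M = "PiM {..<Suc n} (\<lambda>_. \<mu>)"
    define h where "h w = (\<Sum>i<n. D (w i)) ^ m * D (w n)" for w :: "nat \<Rightarrow> complex^'n^'n"
    have h_meas: "h \<in> borel_measurable (PiM {..<Suc n} (\<lambda>_. borel))"
      unfolding h_def by measurable
    have h_bound: "\<bar>h w\<bar> \<le> (real n * B) ^ m * B" for w
    proof -
      have "\<bar>\<Sum>i<n. D (w i)\<bar> \<le> real n * B"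
        using sum_bounded_above[of "{..<n}" "\<lambda>i. \<bar>D (w i)\<bar>" B] sum_abs[of "\<lambda>i. D (w i)" "{..<n}"] D_bound
        by (auto intro: order.trans)
      then show ?thesis
        unfolding h_def abs_mult power_abs
        using D_bound[of "w n"] by (intro mult_mono power_mono) (auto intro: order.trans)
    qed
    have dens: "integrable (density ?M (\<lambda>w. ennreal (weight (Suc n) w))) h"
      unfolding distr_path_restrict[symmetric]
      using h_meas h_bound
      by (intro finite_measure.integrable_const_bound[where B="(real n * B) ^ m * B"]
            prob_space.finite_measure path.prob_space_distr restrict_path_measurable) auto
    have wm: "weight (Suc n) \<in> borel_measurable ?M" and hm: "h \<in> borel_measurable ?M"
      using weight_measurable h_meas by (simp_all add: measurable_PiM_kraus)
    have int: "integrable ?M (\<lambda>w. weight (Suc n) w * h w)"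
      using dens integrable_density[OF hm wm] weight_nonneg by simp
    have step: "(\<integral>v. weight (Suc n) (w(n := v)) * h (w(n := v)) \<partial>\<mu>) = 0"
      if w: "w \<in> space (PiM {..<n} (\<lambda>_. \<mu>))" for w
    proof -
      have "(\<integral>v. weight (Suc n) (w(n := v)) * h (w(n := v)) \<partial>\<mu>) =
          (\<Sum>j\<in>UNIV. \<Sum>i\<in>UNIV. weight (Suc n) (w(n := V i j)) * h (w(n := V i j)))"
        using upd_measurable[OF weight_measurable w] upd_measurable[OF h_meas w]
        by (intro integral_markov_kraus) measurable
      also have "\<dots> = (\<Sum>j\<in>UNIV. (\<Sum>i<n. D (w i)) ^ m * Re (state n w $ j $ j) * (\<Sum>i\<in>UNIV. P $ i $ j * d i j))"
        unfolding sum_distrib_left weight_upd h_def D_def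
        by (intro sum.cong refl) (simp add: edge_observable_markov_kraus)
      finally show ?thesis by (simp add: mean)
    qed
    have "path.expectation (\<lambda>w. (\<Sum>i<n. D (w i)) ^ m * D (w n)) = path.expectation (\<lambda>w. h (restrict w {..<Suc n}))"
      by (simp add: h_def)
    also have "\<dots> = integral\<^sup>L (density ?M (\<lambda>w. ennreal (weight (Suc n) w))) h"
      unfolding distr_path_restrict[symmetric]
      by (rule integral_distr[symmetric, OF restrict_path_measurable h_meas])
    also have "\<dots> = (\<integral>w. weight (Suc n) w * h w \<partial>PiM (insert n {..<n}) (\<lambda>_. \<mu>))"
      using integral_density[OF hm wm] weight_nonneg by (simp add: lessThan_Suc)
    also have "\<dots> = (\<integral>w. (\<integral>v. weight (Suc n) (w(n := v)) * h (w(n := v)) \<partial>\<mu>) \<partial>PiM {..<n} (\<lambda>_. \<mu>))"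
      using int by (intro product_integral_insert) (auto simp: lessThan_Suc)
    also have "\<dots> = (\<integral>w. 0 \<partial>PiM {..<n} (\<lambda>_. \<mu>))"
      by (intro Bochner_Integration.integral_cong refl step)
    finally show "path.expectation (\<lambda>w. (\<Sum>i<n. D (w i)) ^ m * D (w n)) = 0" by simp
  qed
qed

text \<open>
  A cylinder on which \<open>W n w = 0\<close> has density zero, and \<open>\<mu>\<close> charges only the matrices \<open>V i j\<close>.
\<close>
lemma AE_path_admissible:
  "AE w in path. \<forall>n. W n w \<noteq> 0 \<and> (\<exists>i j. w n = V i j)"
proof -
  have "AE w in path. W (Suc n) w \<noteq> 0 \<and> (\<exists>i j. w n = V i j)" for n
  proof -
    let ?M = "PiM {..<Suc n} (\<lambda>_. \<mu>)"
    define good where "good w \<longleftrightarrow> W (Suc n) w \<noteq> 0 \<and> w n \<in> range (case_prod V)" for w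
    have [measurable]: "W (Suc n) \<in> borel_measurable (PiM {..<Suc n} (\<lambda>_. borel))"
      by (rule borel_measurable_matrix_product) measurable
    have "range (case_prod V) \<in> sets borel" by (intro borel_closed finite_imp_closed) simp
    then have [measurable]: "Measurable.pred borel (\<lambda>v. v \<in> range (case_prod V))" by measurable
    have good_meas: "Measurable.pred (PiM {..<Suc n} (\<lambda>_. borel)) good"
      unfolding good_def by measurable
    define h where "h w = (if good w then 0 else ennreal (weight (Suc n) w))" for w
    have h_meas: "h \<in> borel_measurable (PiM {..<Suc n} (\<lambda>_. borel))"
    proof -
      note [measurable] = good_meas weight_measurable[of "Suc n"]
      show ?thesis unfolding h_def by measurable
    qed
    have step: "(\<integral>\<^sup>+v. h (w(n := v)) \<partial>\<mu>) = 0" if w: "w \<in> space (PiM {..<n} (\<lambda>_. \<mu>))" for w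
    proof -
      have "h (w(n := V i j)) = 0" for i j
      proof (cases "W (Suc n) (w(n := V i j)) = 0")
        case True
        then show ?thesis
          by (simp add: h_def weight_eq_sum state_def diag_conjugation_diagonal del: matrix_product.simps)
      next
        case False
        then show ?thesis by (auto simp: h_def good_def simp del: matrix_product.simps)
      qed
      then show ?thesis using nn_integral_markov_kraus[OF upd_measurable[OF h_meas w]] by simp
    qed
    have "(\<integral>\<^sup>+w. h w \<partial>PiM (insert n {..<n}) (\<lambda>_. \<mu>)) = (\<integral>\<^sup>+w. (\<integral>\<^sup>+v. h (w(n := v)) \<partial>\<mu>) \<partial>PiM {..<n} (\<lambda>_. \<mu>))"
      using h_meas by (intro product_nn_integral_insert) (simp_all add: measurable_PiM_kraus flip: lessThan_Suc)
    also have "\<dots> = (\<integral>\<^sup>+w. 0 \<partial>PiM {..<n} (\<lambda>_. \<mu>))"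
      by (intro nn_integral_cong step)
    finally have "(\<integral>\<^sup>+w. h w \<partial>?M) = 0" by (simp add: lessThan_Suc)
    then have "AE w in ?M. h w = 0"
      using h_meas by (subst (asm) nn_integral_0_iff_AE) (simp_all add: measurable_PiM_kraus)
    then have "AE w in ?M. 0 < ennreal (weight (Suc n) w) \<longrightarrow> good w"
      by eventually_elim (auto simp: h_def split: if_splits)
    then have "AE w in distr path (PiM {..<Suc n} (\<lambda>_. borel)) (\<lambda>w. restrict w {..<Suc n}). good w"
      unfolding distr_path_restrict using weight_measurable
      by (subst AE_density) (simp_all add: measurable_PiM_kraus)
    then have good_AE: "AE w in path. good (restrict w {..<Suc n})"
      using good_meas by (subst (asm) AE_distr_iff) (auto intro: restrict_path_measurable)
    have imp: "W (Suc n) w \<noteq> 0 \<and> (\<exists>i j. w n = V i j)" if "good (restrict w {..<Suc n})" for w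
    proof -
      have "W (Suc n) (restrict w {..<Suc n}) = W (Suc n) w"
        by (rule matrix_product_cong) simp
      with that show ?thesis by (auto simp: good_def simp del: matrix_product.simps)
    qed
    show ?thesis using good_AE by eventually_elim (rule imp)
  qed
  then have "AE w in path. \<forall>n. W (Suc n) w \<noteq> 0 \<and> (\<exists>i j. w n = V i j)"
    by (intro AE_all_countable[THEN iffD2] allI)
  then show ?thesis
  proof eventually_elim
    case (elim w)
    have "W 0 w \<noteq> 0" by (auto simp: vec_eq_iff mat_def)
    with elim show ?case by (metis not0_implies_Suc)
  qed
qed

end

section \<open>Products along admissible trajectories\<close>

lemma markov_kraus_mult_matrix_unit:
  "markov_kraus P i j ** (c *\<^sub>R matrix_unit k l) =
    (if j = k then (sqrt (P $ i $ j) * c) *\<^sub>R matrix_unit i l else 0)"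
proof -
  have "(markov_kraus P i j ** (c *\<^sub>R matrix_unit k l)) $ a $ b =
      (if j = k then (sqrt (P $ i $ j) * c) *\<^sub>R matrix_unit i l else 0) $ a $ b" for a b
  proof -
    have "(markov_kraus P i j ** (c *\<^sub>R matrix_unit k l)) $ a $ b =
        (\<Sum>m\<in>UNIV. if m = j then if a = i \<and> j = k \<and> b = l then complex_of_real (sqrt (P $ i $ j) * c) else 0 else 0)"
      unfolding matrix_matrix_mult_def vec_lambda_beta
      by (intro sum.cong refl) (auto simp: markov_kraus_entry scaled_matrix_unit_entry simp del: vector_scaleR_component)
    then show ?thesis by (auto simp: scaled_matrix_unit_entry simp del: vector_scaleR_component)
  qed
  then show ?thesis by (simp add: vec_eq_iff)
qed

text \<open>
  A product of Kraus operators survives only if consecutive transitions fit together, and then it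
  telescopes to a multiple of one matrix unit whose norm is the square root of the probability of
  the trajectory.
\<close>
lemma matrix_product_admissible:
  fixes P :: "real^'n^'n"
  assumes w: "\<And>k. w k = markov_kraus P (a k) (b k)"
    and nz: "\<And>n. matrix_product (\<lambda>v. v) n w \<noteq> 0"
  shows "P $ a n $ b n \<noteq> 0"
    and "b (Suc n) = a n"
    and "matrix_product (\<lambda>v. v) (Suc n) w = (\<Prod>k\<le>n. sqrt (P $ a k $ b k)) *\<^sub>R matrix_unit (a n) (b 0)"
proof -
  have Pnz: "P $ a n $ b n \<noteq> 0" for n
  proof
    assume "P $ a n $ b n = 0"
    then have "w n = 0" by (simp add: w vec_eq_iff markov_kraus_entry)
    then have "matrix_product (\<lambda>v. v) (Suc n) w = 0"
      by (simp add: vec_eq_iff matrix_matrix_mult_def)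
    then show False using nz by blast
  qed
  then show "P $ a n $ b n \<noteq> 0" .
  have prod: "matrix_product (\<lambda>v. v) (Suc n) w = (\<Prod>k\<le>n. sqrt (P $ a k $ b k)) *\<^sub>R matrix_unit (a n) (b 0)
      \<and> b (Suc n) = a n" for n
  proof (induction n)
    case 0
    have 1: "matrix_product (\<lambda>v. v) (Suc 0) w = sqrt (P $ a 0 $ b 0) *\<^sub>R matrix_unit (a 0) (b 0)"
      by (simp add: w markov_kraus_def)
    have "matrix_product (\<lambda>v. v) (Suc (Suc 0)) w = w (Suc 0) ** matrix_product (\<lambda>v. v) (Suc 0) w"
      by (rule matrix_product.simps(2))
    then have "b (Suc 0) = a 0"
      using nz[of "Suc (Suc 0)"] unfolding 1 w markov_kraus_mult_matrix_unit by (auto split: if_splits)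
    with 1 show ?case by simp
  next
    case (Suc n)
    have step: "matrix_product (\<lambda>v. v) (Suc (Suc n)) w = (\<Prod>k\<le>Suc n. sqrt (P $ a k $ b k)) *\<^sub>R matrix_unit (a (Suc n)) (b 0)"
      using Suc unfolding matrix_product.simps(2)[of _ "Suc n"] w[of "Suc n"]
      by (simp add: markov_kraus_mult_matrix_unit mult.commute)
    have "matrix_product (\<lambda>v. v) (Suc (Suc (Suc n))) w = w (Suc (Suc n)) ** matrix_product (\<lambda>v. v) (Suc (Suc n)) w"
      by (rule matrix_product.simps(2))
    then have "b (Suc (Suc n)) = a (Suc n)"
      using nz[of "Suc (Suc (Suc n))"] unfolding step w markov_kraus_mult_matrix_unit by (auto split: if_splits)
    with step show ?case by simp
  qed
  then show "b (Suc n) = a n"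
    and "matrix_product (\<lambda>v. v) (Suc n) w = (\<Prod>k\<le>n. sqrt (P $ a k $ b k)) *\<^sub>R matrix_unit (a n) (b 0)"
    by blast+
qed

section \<open>The Poisson equation and the Lyapunov exponents\<close>

text \<open>
  The Poisson equation turns the centred function \<open>G\<close> into a coboundary up to a martingale
  difference.  With two states the solution is \<open>g 1 = (G 1 - G 2) / (p\<^sub>1\<^sub>2 + p\<^sub>2\<^sub>1)\<close>, \<open>g 2 = 0\<close>, and it
  exists because irreducibility makes the denominator positive.
\<close>
lemma poisson_equation_2:
  fixes P :: "real^2^2"
  assumes P: "column_stochastic P" "irreducible_matrix P" and p: "invariant_probability P p"
  obtains g where "\<And>j. G j - (\<Sum>k\<in>UNIV. p $ k * G k) = g j - (\<Sum>i\<in>UNIV. P $ i $ j * g i :: real)"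
proof -
  have nonneg: "0 \<le> P $ 1 $ 2" "0 \<le> P $ 2 $ 1"
    and cols: "P $ 1 $ 1 = 1 - P $ 2 $ 1" "P $ 2 $ 2 = 1 - P $ 1 $ 2"
    using P(1) by (auto simp: column_stochastic_def UNIV_2 forall_2)
  have p2: "p $ 2 = 1 - p $ 1" using p by (simp add: invariant_probability_def UNIV_2)
  have "(P *v p) $ 1 = p $ 1" using p by (simp add: invariant_probability_def)
  then have inv: "(P $ 1 $ 2 + P $ 2 $ 1) * p $ 1 = P $ 1 $ 2"
    by (simp add: matrix_vector_mult_def UNIV_2 p2 cols algebra_simps)
  have "P $ 1 $ 2 \<noteq> 0"
  proof
    assume 0: "P $ 1 $ 2 = 0"
    have "(((**) P ^^ n) (mat 1)) $ 1 $ 2 = 0" for n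
      by (induction n) (auto simp: mat_def matrix_matrix_mult_def UNIV_2 0)
    moreover obtain n where "0 < (((**) P ^^ n) (mat 1)) $ 1 $ 2"
      using P(2) by (auto simp: irreducible_matrix_def)
    ultimately show False by simp
  qed
  then have s: "P $ 1 $ 2 + P $ 2 $ 1 \<noteq> 0" using nonneg by simp
  define s where "s = P $ 1 $ 2 + P $ 2 $ 1"
  have p1: "p $ 1 = P $ 1 $ 2 / s" using inv s by (simp add: s_def field_simps)
  have p2': "p $ 2 = P $ 2 $ 1 / s" using s unfolding p2 p1 by (simp add: s_def field_simps)
  define g where "g i = (if i = 1 then (G 1 - G 2) / s else 0)" for i :: 2
  have "s \<noteq> 0" using s by (simp add: s_def)
  then have "G j - (\<Sum>k\<in>UNIV. p $ k * G k) = g j - (\<Sum>i\<in>UNIV. P $ i $ j * g i)" for j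
    using exhaust_2[of j]
    by (auto simp: sum_2 p1 p2' g_def cols field_simps) (auto simp: s_def algebra_simps)
  then show thesis using that by blast
qed

text \<open>
  With \<open>G j\<close> the conditional mean of \<open>ln p\<^sub>i\<^sub>j\<close> given \<open>j\<close> and \<open>g\<close> a solution of the Poisson equation,
  \<open>d i j = ln p\<^sub>i\<^sub>j - m + g i - g j\<close> has conditional mean zero.  Along an admissible path the terms in \<open>g\<close>
  telescope and stay bounded, so the law of large numbers for \<open>d\<close> is one for \<open>ln p\<^sub>i\<^sub>j\<close>.
\<close>
lemma AE_path_lyapunov:
  fixes P :: "real^2^2"
  assumes P: "column_stochastic P" "irreducible_matrix P" and p: "invariant_probability P p"
  defines "Q \<equiv> path_measure (\<lambda>v. v) (markov_kraus_measure P) (diag_matrix p)"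
  shows "prob_space Q"
    and "AE w in Q. (\<lambda>n. ereal (1 / real n) * ereal_log (operator_norm (matrix_product (\<lambda>v. v) n w)))
      \<longlonglongrightarrow> ereal (- (1 / 2) * markov_entropy P p)"
    and "AE w in Q. (\<lambda>n. ereal (1 / real n) * ereal_log (ext_power_norm 2 (matrix_product (\<lambda>v. v) n w)))
      \<longlonglongrightarrow> - \<infinity>"
proof -
  interpret kraus_chain P p
    using P p by unfold_locales (auto simp: invariant_probability_def)
  show "prob_space Q" unfolding Q_def by (rule prob_space_path)
  define G where "G j = (\<Sum>i\<in>UNIV. P $ i $ j * ln (P $ i $ j))" for j
  define m where "m = (\<Sum>j\<in>UNIV. p $ j * G j)"
  have m: "m = - markov_entropy P p"
    unfolding m_def G_def markov_entropy_def sum_distrib_left by (subst sum.swap) (simp add: mult.assoc)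
  obtain g where g: "\<And>j. G j - m = g j - (\<Sum>i\<in>UNIV. P $ i $ j * g i)"
    using poisson_equation_2[OF P p, of G] unfolding m_def by blast
  define d where "d i j = ln (P $ i $ j) - m + g i - g j" for i j
  have "(\<Sum>i\<in>UNIV. P $ i $ j * d i j) = 0" for j
  proof -
    have "(\<Sum>i\<in>UNIV. P $ i $ j * d i j) = G j - m * (\<Sum>i\<in>UNIV. P $ i $ j)
        + (\<Sum>i\<in>UNIV. P $ i $ j * g i) - g j * (\<Sum>i\<in>UNIV. P $ i $ j)"
      by (simp add: d_def G_def algebra_simps sum.distrib sum_subtractf sum_distrib_left)
    then show ?thesis using g[of j] by (simp add: P_col_sum)
  qed
  then have slln: "AE w in Q. (\<lambda>n. (\<Sum>k<n. edge_observable d (w k)) / real n) \<longlonglongrightarrow> 0"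
    unfolding Q_def by (rule edge_observable_slln)
  have adm: "AE w in Q. \<forall>n. W n w \<noteq> 0 \<and> (\<exists>i j. w n = V i j)"
    unfolding Q_def by (rule AE_path_admissible)
  have conv: "(\<lambda>n. ereal (1 / real n) * ereal_log (operator_norm (W n w))) \<longlonglongrightarrow> ereal (- (1 / 2) * markov_entropy P p)
      \<and> (\<lambda>n. ereal (1 / real n) * ereal_log (ext_power_norm 2 (W n w))) \<longlonglongrightarrow> - \<infinity>"
    if lim: "(\<lambda>n. (\<Sum>k<n. edge_observable d (w k)) / real n) \<longlonglongrightarrow> 0"
      and w: "\<forall>n. W n w \<noteq> 0 \<and> (\<exists>i j. w n = V i j)" for w
  proof -
    obtain a b where ab: "\<And>k. w k = V (a k) (b k)" using w by metis
    have nz: "W n w \<noteq> 0" for n using w by blast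
    note adm = matrix_product_admissible[OF ab nz]
    have pos: "0 < P $ a k $ b k" for k using adm(1)[of k] P_nonneg[of "a k" "b k"] by simp
    define S where "S n = (\<Sum>k<n. ln (P $ a k $ b k))" for n
    \<comment> \<open>The sums start at \<open>Suc n\<close>: the empty product is the identity, not a multiple of a matrix unit.\<close>
    have tele: "(\<Sum>k<Suc n. edge_observable d (w k)) = S (Suc n) - real (Suc n) * m + g (a n) - g (b 0)" for n
      by (induction n) (simp_all add: S_def ab edge_observable_markov_kraus adm(1) d_def adm(2) algebra_simps)
    define C where "C = \<bar>g 1\<bar> + \<bar>g 2\<bar>"
    have g_bound: "\<bar>g (a n) - g (b 0)\<bar> \<le> 2 * C" for n
      using exhaust_2[of "a n"] exhaust_2[of "b 0"] by (auto simp: C_def)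
    have "(\<lambda>n. (g (a n) - g (b 0)) / real (Suc n)) \<longlonglongrightarrow> 0"
    proof (rule Lim_null_comparison)
      show "\<forall>\<^sub>F n in sequentially. norm ((g (a n) - g (b 0)) / real (Suc n)) \<le> 2 * C / real (Suc n)"
        using g_bound by (intro always_eventually allI) (simp add: divide_right_mono)
      show "(\<lambda>n. 2 * C / real (Suc n)) \<longlonglongrightarrow> 0"
        by (rule LIMSEQ_Suc[OF lim_const_over_n])
    qed
    with LIMSEQ_Suc[OF lim] have "(\<lambda>n. (\<Sum>k<Suc n. edge_observable d (w k)) / real (Suc n)
        - (g (a n) - g (b 0)) / real (Suc n) + m) \<longlonglongrightarrow> 0 - 0 + m"
      by (intro tendsto_intros)
    moreover have "(\<Sum>k<Suc n. edge_observable d (w k)) / real (Suc n)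
        - (g (a n) - g (b 0)) / real (Suc n) + m = S (Suc n) / real (Suc n)" for n
      unfolding tele by (simp add: add_divide_distrib diff_divide_distrib)
    ultimately have "(\<lambda>n. S (Suc n) / real (Suc n)) \<longlonglongrightarrow> m" by simp
    then have "(\<lambda>n. 1 / 2 * (S (Suc n) / real (Suc n))) \<longlonglongrightarrow> 1 / 2 * m"
      by (intro tendsto_intros)
    moreover have "ereal (1 / real (Suc n)) * ereal_log (operator_norm (W (Suc n) w)) =
        ereal (1 / 2 * (S (Suc n) / real (Suc n)))" for n
    proof -
      define c where "c = (\<Prod>k\<le>n. sqrt (P $ a k $ b k))"
      have "0 < c" unfolding c_def using pos by (intro prod_pos) auto
      then have log: "ereal_log c = ereal (ln c)" by (simp add: ereal_log_def)
      have "ln c = 1 / 2 * S (Suc n)"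
        by (simp add: c_def ln_prod ln_sqrt[OF P_nonneg] adm(1) S_def sum_divide_distrib lessThan_Suc_atMost)
      then have ln: "1 / real (Suc n) * ln c = 1 / 2 * (S (Suc n) / real (Suc n))"
        by (simp only: times_divide_times_eq times_divide_eq_right times_divide_eq_left) simp
      show ?thesis
        unfolding adm(3) c_def[symmetric] operator_norm_matrix_unit
        using \<open>0 < c\<close> by (simp only: abs_of_pos log times_ereal.simps ln)
    qed
    ultimately have "(\<lambda>n. ereal (1 / real (Suc n)) * ereal_log (operator_norm (W (Suc n) w))) \<longlonglongrightarrow> ereal (1 / 2 * m)"
      by (simp only: lim_ereal)
    then have 1: "(\<lambda>n. ereal (1 / real n) * ereal_log (operator_norm (W n w))) \<longlonglongrightarrow> ereal (1 / 2 * m)"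
      by (rule LIMSEQ_imp_Suc)
    have "(\<lambda>n. ereal (1 / real (Suc n)) * ereal_log (ext_power_norm 2 (W (Suc n) w))) \<longlonglongrightarrow> - \<infinity>"
      unfolding adm(3) ext_power_norm_matrix_unit by (simp add: ereal_log_def)
    then have "(\<lambda>n. ereal (1 / real n) * ereal_log (ext_power_norm 2 (W n w))) \<longlonglongrightarrow> - \<infinity>"
      by (rule LIMSEQ_imp_Suc)
    with 1 show ?thesis by (simp add: m)
  qed
  show "AE w in Q. (\<lambda>n. ereal (1 / real n) * ereal_log (operator_norm (W n w)))
      \<longlonglongrightarrow> ereal (- (1 / 2) * markov_entropy P p)"
    using slln adm by eventually_elim (rule conv[THEN conjunct1])
  show "AE w in Q. (\<lambda>n. ereal (1 / real n) * ereal_log (ext_power_norm 2 (W n w))) \<longlonglongrightarrow> - \<infinity>"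
    using slln adm by eventually_elim (rule conv[THEN conjunct2])
qed

theorem mainTheorem2:
  fixes P :: "real^2^2" and \<pi> :: "real^2" and \<gamma>\<^sub>1 \<gamma>\<^sub>2 :: ereal
  assumes "column_stochastic P"
    and "irreducible_matrix P"
    and "invariant_probability P \<pi>"
  shows "lyapunov_exponents (\<lambda>v. v) (markov_kraus_measure P) (diag_matrix \<pi>) \<gamma>\<^sub>1 \<gamma>\<^sub>2 \<longleftrightarrow>
    \<gamma>\<^sub>1 = ereal (1 / 2 * (\<Sum>i\<in>UNIV. \<Sum>j\<in>UNIV. \<pi> $ j * P $ i $ j * ln (P $ i $ j))) \<and>
    \<gamma>\<^sub>1 = ereal (- (1 / 2) * markov_entropy P \<pi>) \<and>
    \<gamma>\<^sub>2 = -\<infinity>"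
proof -
  let ?Q = "path_measure (\<lambda>v. v) (markov_kraus_measure P) (diag_matrix \<pi>)"
  note L = AE_path_lyapunov[OF assms]
  interpret Q: prob_space ?Q by (rule L(1))
  have h: "1 / 2 * (\<Sum>i\<in>UNIV. \<Sum>j\<in>UNIV. \<pi> $ j * P $ i $ j * ln (P $ i $ j)) = - (1 / 2) * markov_entropy P \<pi>"
    by (simp add: markov_entropy_def)
  \<comment> \<open>Two almost sure limits of one sequence agree because a probability space is not null.\<close>
  have unique: "x = y" if "AE w in ?Q. f w \<longlonglongrightarrow> x" "AE w in ?Q. f w \<longlonglongrightarrow> y"
    for x y :: ereal and f :: "(nat \<Rightarrow> complex^2^2) \<Rightarrow> nat \<Rightarrow> ereal"
  proof -
    have "AE w in ?Q. x = y" using that by eventually_elim (rule LIMSEQ_unique)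
    then show ?thesis by simp
  qed
  show ?thesis
    unfolding h
  proof (intro iffI conjI)
    assume "lyapunov_exponents (\<lambda>v. v) (markov_kraus_measure P) (diag_matrix \<pi>) \<gamma>\<^sub>1 \<gamma>\<^sub>2"
    then have *: "AE w in ?Q. (\<lambda>n. ereal (1 / real n) * ereal_log (operator_norm (matrix_product (\<lambda>v. v) n w))) \<longlonglongrightarrow> \<gamma>\<^sub>1"
      "AE w in ?Q. (\<lambda>n. ereal (1 / real n) * ereal_log (ext_power_norm 2 (matrix_product (\<lambda>v. v) n w))) \<longlonglongrightarrow> \<gamma>\<^sub>1 + \<gamma>\<^sub>2"
      by (simp_all add: lyapunov_exponents_def)
    show g1: "\<gamma>\<^sub>1 = ereal (- (1 / 2) * markov_entropy P \<pi>)"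
      using unique[OF *(1) L(2)] .
    then show "\<gamma>\<^sub>1 = ereal (- (1 / 2) * markov_entropy P \<pi>)" .
    show "\<gamma>\<^sub>2 = - \<infinity>"
      using unique[OF *(2) L(3)] g1 by (cases \<gamma>\<^sub>2) auto
  next
    assume *: "\<gamma>\<^sub>1 = ereal (- (1 / 2) * markov_entropy P \<pi>) \<and> \<gamma>\<^sub>1 = ereal (- (1 / 2) * markov_entropy P \<pi>) \<and> \<gamma>\<^sub>2 = - \<infinity>"
    then have "\<gamma>\<^sub>1 + \<gamma>\<^sub>2 = - \<infinity>" by simp
    with * L(2,3) show "lyapunov_exponents (\<lambda>v. v) (markov_kraus_measure P) (diag_matrix \<pi>) \<gamma>\<^sub>1 \<gamma>\<^sub>2"
      by (simp add: lyapunov_exponents_def)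
  qed
qed

end
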